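(* For any norm $\nu$ on $\mathbb{R}^2$, the set $\widehat D_\nu:=\bigcup_{c<1}D_\nu(c\psi_1)\subset\mathbb{R}$, where $\psi_1(t)=1/t$, is absolute winning.
   Context: For a norm $\nu$ on $\mathbb{R}^2$ let $B_\nu(r)=\{\mathbf{x}\in\mathbb{R}^2:\nu(\mathbf{x})<r\}$ and let $\Delta_\nu$ be the smallest covolume of a lattice in $\mathbb{R}^2$ intersecting $B_\nu(1)$ only in $\{0\}$. For $\alpha\in\mathbb{R}$ let $\Lambda_\alpha=\{(\alpha q-p,\,q)^T:p,q\in\mathbb{Z}\}$. For a positive function $\psi$ defined on some $[t_0,\infty)$, $\alpha\in D_\nu(\psi)$ means: for all sufficiently large $t>0$, $\Lambda_\alpha\cap \operatorname{diag}(\psi(t),t)\,B_\nu(1/\sqrt{\Delta_\nu})\neq\{0\}$. "Absolute winning" is in the sense of McMullen's absolute game on $\mathbb{R}$. *)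

theory Defs
  imports "HOL-Analysis.Analysis"
begin

definition is_norm :: "(real^2 \<Rightarrow> real) \<Rightarrow> bool" where
  "is_norm \<nu> \<longleftrightarrow>
     (\<forall>x. 0 \<le> \<nu> x) \<and>
     (\<forall>x. \<nu> x = 0 \<longleftrightarrow> x = 0) \<and>
     (\<forall>a x. \<nu> (a *\<^sub>R x) = \<bar>a\<bar> * \<nu> x) \<and>
     (\<forall>x y. \<nu> (x + y) \<le> \<nu> x + \<nu> y)"

definition norm_ball :: "(real^2 \<Rightarrow> real) \<Rightarrow> real \<Rightarrow> (real^2) set" where
  "norm_ball \<nu> r = {x. \<nu> x < r}"

text \<open>The lattice spanned by the columns of an invertible matrix \<open>g\<close>; its covolume is
  \<open>\<bar>det g\<bar>\<close>, and every (full-rank) lattice in the plane is of this form.\<close>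

definition lattice_of :: "real^2^2 \<Rightarrow> (real^2) set" where
  "lattice_of g = {g *v z | z. \<forall>i. z $ i \<in> \<int>}"

text \<open>The set of covolumes below is nonempty and bounded below by \<open>0\<close>; by Mahler's compactness
  criterion it contains its infimum, which is therefore the smallest such covolume.\<close>

definition crit_covolume :: "(real^2 \<Rightarrow> real) \<Rightarrow> real" where
  "crit_covolume \<nu> =
     Inf {\<bar>det g\<bar> | g. invertible g \<and> lattice_of g \<inter> norm_ball \<nu> 1 = {0}}"

definition diag2 :: "real \<Rightarrow> real \<Rightarrow> real^2^2" where
  "diag2 a b = vector [vector [a, 0], vector [0, b]]"

definition Lambda :: "real \<Rightarrow> (real^2) set" where
  "Lambda \<alpha> = {vector [\<alpha> * of_int q - of_int p, of_int q] | (p::int) (q::int). True}"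

definition Dset :: "(real^2 \<Rightarrow> real) \<Rightarrow> (real \<Rightarrow> real) \<Rightarrow> real set" where
  "Dset \<nu> \<psi> = {\<alpha>. \<forall>\<^sub>F t in at_top.
     Lambda \<alpha> \<inter> (\<lambda>x. diag2 (\<psi> t) t *v x) ` norm_ball \<nu> (1 / sqrt (crit_covolume \<nu>)) \<noteq> {0}}"

definition psi1 :: "real \<Rightarrow> real" where
  "psi1 t = 1 / t"

text \<open>The functions \<open>\<psi>\<close> are positive, so only \<open>c > 0\<close> occurs in the union over \<open>c < 1\<close>.\<close>

definition Dhat :: "(real^2 \<Rightarrow> real) \<Rightarrow> real set" where
  "Dhat \<nu> = (\<Union>c\<in>{0<..<1}. Dset \<nu> (\<lambda>t. c * psi1 t))"

text \<open>McMullen's absolute game on the line. A closed interval of positive length is encoded as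
  (centre, radius). Bob moves first; Alice's strategy \<open>\<sigma>\<close> maps the nonempty list of Bob's moves
  so far (oldest first) to the interval she removes.\<close>

type_synonym interval = "real \<times> real"

definition ivl :: "interval \<Rightarrow> real set" where
  "ivl I = cball (fst I) (snd I)"

text \<open>Legality of Alice's moves is required for every history, so that she cannot win vacuously
  by an illegal move that leaves Bob without an answer.\<close>

definition alice_strategy :: "real \<Rightarrow> (interval list \<Rightarrow> interval) \<Rightarrow> bool" where
  "alice_strategy \<beta> \<sigma> \<longleftrightarrow>
     (\<forall>h. h \<noteq> [] \<and> 0 < snd (last h) \<longrightarrow>
        0 < snd (\<sigma> h) \<and> snd (\<sigma> h) \<le> \<beta> * snd (last h))"

definition bob_play :: "real \<Rightarrow> (interval list \<Rightarrow> interval) \<Rightarrow> (nat \<Rightarrow> interval) \<Rightarrow> bool" where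
  "bob_play \<beta> \<sigma> B \<longleftrightarrow>
     0 < snd (B 0) \<and>
     (\<forall>n. snd (B (Suc n)) \<ge> \<beta> * snd (B n) \<and>
          ivl (B (Suc n)) \<subseteq> ivl (B n) - ivl (\<sigma> (map B [0..<Suc n])))"

definition absolute_winning :: "real set \<Rightarrow> bool" where
  "absolute_winning S \<longleftrightarrow>
     (\<forall>\<beta>. 0 < \<beta> \<and> \<beta> < 1/3 \<longrightarrow>
        (\<exists>\<sigma>. alice_strategy \<beta> \<sigma> \<and>
             (\<forall>B. bob_play \<beta> \<sigma> B \<longrightarrow> (\<Inter>n. ivl (B n)) \<inter> S \<noteq> {})))"

end

theory Submission
  imports Defs
begin

text \<open>
  Put \<open>y = 1 / t\<^sup>2\<close> and \<open>r = 1 / sqrt \<Delta>\<close>. For fixed integers \<open>(p, q)\<close> the region of the points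
  \<open>(x, y)\<close> at which \<open>\<nu> (q x - p, q y) < r sqrt y\<close> is convex, and by the definition of \<open>\<Delta>\<close> the
  closures of these regions cover the half-plane. A number \<open>\<alpha>\<close> can fail to lie in \<open>Dhat\<close> only if
  for each \<open>\<epsilon> > 0\<close> there are arbitrarily small \<open>y\<close> such that \<open>(\<alpha>, y)\<close> is bad: it lies in none of the
  smaller regions in which \<open>r\<close> is replaced by \<open>r - \<epsilon>\<close>.
  By convexity a bad point is nearly determined by the set of integer vectors that are almost
  shortest there, unless one of these vectors is almost horizontal. Hence in a window of width and
  height comparable to \<open>y\<close> the bad points have abscissae in boundedly many arbitrarily short intervals.
  An almost horizontal vector means that \<open>\<alpha>\<close> is too close to a rational, and there are boundedly
  many such rationals per window as well.
  Alice lets these dangerous points accumulate for \<open>D\<close> turns, which yields \<open>O(D)\<close> of them, and then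
  disposes of them in the next \<open>D\<close> turns by repeatedly removing a neighbourhood of their median;
  as \<open>O(D) < 2 ^ D\<close> for large \<open>D\<close>, none survives.
\<close>

section \<open>The absolute game\<close>


text \<open>Supplies the point at which Alice centres the interval that she removes: whichever side
  of it Bob then takes, at most half of the points lie on that side.\<close>

lemma finite_set_median:
  fixes A :: "real set"
  assumes "finite A"
  obtains m where "2 * card {a \<in> A. m < a} \<le> card A" "2 * card {a \<in> A. a < m} \<le> card A"
proof (cases "A = {}")
  case True
  then show ?thesis using that[of 0] by simp
next
  case False
  define xs where "xs = sorted_list_of_set A"
  \<comment> \<open>The upper median: at most \<open>k\<close> elements are smaller and at most
    \<open>card A - k - 1\<close> are larger.\<close>
  define k where "k = length xs div 2"
  have xs: "set xs = A" "sorted xs" "distinct xs" "length xs = card A"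
    using assms by (auto simp: xs_def)
  have k: "k < length xs"
    using False assms xs(4) by (simp add: k_def card_gt_0_iff)
  have "{a \<in> A. xs ! k < a} \<subseteq> (!) xs ` {Suc k..<length xs}"
  proof
    fix a assume a: "a \<in> {a \<in> A. xs ! k < a}"
    then obtain i where i: "i < length xs" "a = xs ! i" using xs(1) by (metis (no_types, lifting) in_set_conv_nth mem_Collect_eq)
    then have "k < i" using a sorted_nth_mono[OF xs(2), of i k] k by force
    then show "a \<in> (!) xs ` {Suc k..<length xs}" using i by auto
  qed
  then have "card {a \<in> A. xs ! k < a} \<le> card {Suc k..<length xs}"
    by (meson card_image_le card_mono finite_atLeastLessThan finite_imageI le_trans)
  moreover have "{a \<in> A. a < xs ! k} \<subseteq> (!) xs ` {..<k}"
  proof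
    fix a assume a: "a \<in> {a \<in> A. a < xs ! k}"
    then obtain i where i: "i < length xs" "a = xs ! i" using xs(1) by (metis (no_types, lifting) in_set_conv_nth mem_Collect_eq)
    then have "i < k" using a sorted_nth_mono[OF xs(2), of k i] by force
    then show "a \<in> (!) xs ` {..<k}" using i by auto
  qed
  then have "card {a \<in> A. a < xs ! k} \<le> card {..<k}"
    by (meson card_image_le card_mono finite_lessThan finite_imageI le_trans)
  ultimately show ?thesis using that[of "xs ! k"] xs(4) by (simp add: k_def)
qed

text \<open>What remains of \<open>bob_play\<close> when Alice's moves are forgotten. Dangerous
  points are counted for such plays, so that the count is available before the strategy that is
  built from it.\<close>

definition nested_play :: "real \<Rightarrow> (nat \<Rightarrow> interval) \<Rightarrow> bool" where
  "nested_play \<beta> B \<longleftrightarrow> 0 < snd (B 0) \<and>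
     (\<forall>n. \<beta> * snd (B n) \<le> snd (B (Suc n)) \<and> ivl (B (Suc n)) \<subseteq> ivl (B n))"

lemma bob_play_nested: "bob_play \<beta> \<sigma> B \<Longrightarrow> nested_play \<beta> B"
  unfolding bob_play_def nested_play_def by blast

context
  fixes \<beta> :: real and B :: "nat \<Rightarrow> interval"
  assumes \<beta>: "0 < \<beta>" "\<beta> < 1 / 3" and play: "nested_play \<beta> B"
begin

lemma nested_play_radius_pos: "0 < snd (B n)"
proof (induction n)
  case 0
  then show ?case using play by (simp add: nested_play_def)
next
  case (Suc n)
  then have "0 < \<beta> * snd (B n)" using \<beta> by simp
  then show ?case using play unfolding nested_play_def by (meson less_le_trans)
qed

lemma nested_play_subset: "m \<le> n \<Longrightarrow> ivl (B n) \<subseteq> ivl (B m)"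
  by (rule lift_Suc_antimono_le[where f = "\<lambda>n. ivl (B n)"]) (use play in \<open>auto simp: nested_play_def\<close>)

lemma nested_play_radius_mono:
  assumes "m \<le> n"
  shows "snd (B n) \<le> snd (B m)"
proof -
  have "cball (fst (B n)) (snd (B n)) \<subseteq> cball (fst (B m)) (snd (B m))"
    using nested_play_subset[OF assms] by (simp add: ivl_def)
  then show ?thesis
    using nested_play_radius_pos[of n] cball_subset_cball_iff[of "fst (B n)" "snd (B n)" "fst (B m)" "snd (B m)"]
    by (smt (verit) zero_le_dist)
qed

lemma nested_play_radius_ge: "\<beta> ^ k * snd (B n) \<le> snd (B (n + k))"
proof (induction k)
  case (Suc k)
  have "\<beta> ^ Suc k * snd (B n) = \<beta> * (\<beta> ^ k * snd (B n))" by simp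
  also have "\<dots> \<le> \<beta> * snd (B (n + k))" using Suc \<beta> by (intro mult_left_mono) auto
  also have "\<dots> \<le> snd (B (n + Suc k))" using play by (simp add: nested_play_def)
  finally show ?case .
qed simp

end

text \<open>Bob's next interval avoids the removed one, hence lies on one side of the point at which
  that interval is centred; if this point is a median of the points still dangerous, at most half
  of them survive the turn. A batch of fewer than \<open>2 ^ D\<close> points is thus disposed of in \<open>D\<close> turns.\<close>

lemma alice_avoids_batches:
  fixes \<beta> :: real and D :: nat and Bad :: "interval list \<Rightarrow> real set"
  assumes \<beta>: "0 < \<beta>" "\<beta> < 1 / 3" and D: "0 < D"
    and coverable: "\<And>B i. nested_play \<beta> B \<Longrightarrow> \<exists>C. finite C \<and> card C < 2 ^ D \<and>
      Bad (map B [0..<Suc (i * D)]) \<inter> ivl (B (i * D)) \<subseteq> (\<Union>P\<in>C. cball P (\<beta> ^ Suc D * snd (B (i * D))))"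
  shows "\<exists>\<sigma>. alice_strategy \<beta> \<sigma> \<and> (\<forall>B. bob_play \<beta> \<sigma> B \<longrightarrow>
      (\<forall>i. ivl (B (Suc i * D)) \<inter> Bad (map B [0..<Suc (i * D)]) = {}))"
proof -
  define covers where "covers h C \<longleftrightarrow> finite C \<and> card C < 2 ^ D \<and>
      Bad h \<inter> ivl (last h) \<subseteq> (\<Union>P\<in>C. cball P (\<beta> ^ Suc D * snd (last h)))" for h C
  \<comment> \<open>One covering configuration is fixed for each history; the default
    \<open>{}\<close> keeps \<open>conf h\<close> finite for every \<open>h\<close>.\<close>
  define conf where "conf h = (if \<exists>C. covers h C then SOME C. covers h C else {})" for h
  have conf_covers: "covers h (conf h)" if "\<exists>C. covers h C" for h
    using that someI_ex[OF that] by (simp add: conf_def)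
  have conf_fin: "finite (conf h)" for h
    using conf_covers[of h] by (cases "\<exists>C. covers h C") (auto simp: covers_def conf_def)
  \<comment> \<open>The last index of \<open>h\<close> is rounded down to a multiple of
    \<open>D\<close>, so throughout the \<open>D\<close> turns of a batch Alice refers to the
    configuration chosen at its start.\<close>
  define start where "start h = take (Suc ((length h - 1) div D * D)) h" for h :: "interval list"
  \<comment> \<open>The centres whose intervals can still meet Bob's interval
    \<open>I\<close>.\<close>
  define alive where "alive h0 I = {P \<in> conf h0. \<bar>P - fst I\<bar> \<le> snd I + \<beta> ^ Suc D * snd (last h0)}"
    for h0 :: "interval list" and I :: interval
  define med :: "real set \<Rightarrow> real" where
    "med A = (SOME m. 2 * card {a \<in> A. m < a} \<le> card A \<and> 2 * card {a \<in> A. a < m} \<le> card A)" for A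
  have med: "2 * card {a \<in> A. med A < a} \<le> card A \<and> 2 * card {a \<in> A. a < med A} \<le> card A"
    if "finite A" for A
    unfolding med_def by (rule someI_ex) (use finite_set_median[OF that] in metis)
  define \<sigma> where "\<sigma> h = (med (alive (start h) (last h)), \<beta> * snd (last h))" for h
  have "alice_strategy \<beta> \<sigma>"
    using \<beta> by (auto simp: alice_strategy_def \<sigma>_def)
  moreover have "ivl (B (Suc i * D)) \<inter> Bad (map B [0..<Suc (i * D)]) = {}" if bob: "bob_play \<beta> \<sigma> B" for B i
  proof -
    note nested = bob_play_nested[OF bob]
    define h0 where "h0 = map B [0..<Suc (i * D)]"
    define R where "R = snd (B (i * D))"
    have last_h0: "last h0 = B (i * D)" by (simp add: h0_def)
    have Rpos: "0 < R" unfolding R_def by (rule nested_play_radius_pos[OF \<beta> nested])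
    have "\<exists>C. covers h0 C" using coverable[OF nested, of i] unfolding covers_def last_h0 unfolding h0_def .
    then have cov: "covers h0 (conf h0)" by (rule conf_covers)
    define A where "A j = alive h0 (B (i * D + j))" for j
    have finA: "finite (A j)" for j using conf_fin by (simp add: A_def alive_def)
    have step: "2 * card (A (Suc j)) \<le> card (A j)" if j: "j < D" for j
    proof -
      define n where "n = i * D + j"
      define m where "m = med (A j)"
      have "(i * D + j) div D = i" using j D by simp
      then have "start (map B [0..<Suc n]) = h0"
        using j by (simp add: start_def h0_def n_def take_map del: upt_Suc)
      then have \<sigma>n: "\<sigma> (map B [0..<Suc n]) = (m, \<beta> * snd (B n))"
        by (simp add: \<sigma>_def m_def A_def n_def)
      have sub: "ivl (B (Suc n)) \<subseteq> ivl (B n) - cball m (\<beta> * snd (B n))"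
      proof -
        have "ivl (B (Suc n)) \<subseteq> ivl (B n) - ivl (\<sigma> (map B [0..<Suc n]))"
          using bob unfolding bob_play_def by blast
        then show ?thesis unfolding \<sigma>n by (simp add: ivl_def)
      qed
      define c where "c = fst (B (Suc n))"
      define r where "r = snd (B (Suc n))"
      have r: "0 < r" unfolding r_def by (rule nested_play_radius_pos[OF \<beta> nested])
      have cb: "cball c r \<subseteq> cball (fst (B n)) (snd (B n))" "cball c r \<inter> cball m (\<beta> * snd (B n)) = {}"
        using sub by (auto simp: ivl_def c_def r_def)
      have contains: "\<bar>c - fst (B n)\<bar> + r \<le> snd (B n)"
        using cb(1) r unfolding cball_subset_cball_iff by (simp add: dist_real_def)
      have far: "r + \<beta> * snd (B n) < \<bar>c - m\<bar>"
      proof (rule ccontr)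
        assume "\<not> ?thesis"
        then have le: "\<bar>c - m\<bar> \<le> r + \<beta> * snd (B n)" by simp
        have b0: "0 < \<beta> * snd (B n)" using \<beta> nested_play_radius_pos[OF \<beta> nested] by simp
        \<comment> \<open>The point of \<open>cball c r\<close> nearest to \<open>m\<close>.\<close>
        define z where "z = (if \<bar>c - m\<bar> \<le> r then m else if m < c then c - r else c + r)"
        have "z \<in> cball c r" "z \<in> cball m (\<beta> * snd (B n))"
          using le r b0 by (auto simp: z_def dist_real_def)
        then show False using cb(2) by blast
      qed
      \<comment> \<open>The reason for the exponent \<open>Suc D\<close>: during the whole batch the
        removed interval is at least as large as those round the dangerous points, so a centre that
        is not on Bob's side of \<open>m\<close> can no longer reach Bob's interval.\<close>
      have small: "\<beta> ^ Suc D * R \<le> \<beta> * snd (B n)"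
      proof -
        have "\<beta> ^ D * R \<le> \<beta> ^ j * R" using j \<beta> Rpos by (intro mult_right_mono power_decreasing) auto
        also have "\<dots> \<le> snd (B n)" unfolding R_def n_def by (rule nested_play_radius_ge[OF \<beta> nested])
        finally show ?thesis using \<beta> by (simp add: mult.assoc)
      qed
      have surv: "P \<in> A j \<and> (if m < c then m < P else P < m)" if "P \<in> A (Suc j)" for P
      proof -
        have P: "P \<in> conf h0" "\<bar>P - c\<bar> \<le> r + \<beta> ^ Suc D * R"
          using that by (auto simp: A_def alive_def c_def r_def n_def last_h0 R_def)
        then have "\<bar>P - fst (B n)\<bar> \<le> snd (B n) + \<beta> ^ Suc D * R" using contains by linarith
        then have "P \<in> A j" using P by (simp add: A_def alive_def n_def last_h0 R_def)
        then show ?thesis using P(2) far small by auto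
      qed
      have "A (Suc j) \<subseteq> {a \<in> A j. m < a} \<or> A (Suc j) \<subseteq> {a \<in> A j. a < m}"
        using surv by (cases "m < c") auto
      then have "card (A (Suc j)) \<le> card {a \<in> A j. m < a} \<or> card (A (Suc j)) \<le> card {a \<in> A j. a < m}"
        using finA[of j] card_mono[of "{a \<in> A j. m < a}" "A (Suc j)"] card_mono[of "{a \<in> A j. a < m}" "A (Suc j)"]
        by auto
      then show ?thesis using med[OF finA, of j] unfolding m_def by linarith
    qed
    have halving: "j \<le> D \<Longrightarrow> 2 ^ j * card (A j) \<le> card (A 0)" for j
    proof (induction j)
      case (Suc j)
      have "2 ^ Suc j * card (A (Suc j)) = 2 ^ j * (2 * card (A (Suc j)))" by simp
      also have "\<dots> \<le> 2 ^ j * card (A j)" using step[of j] Suc.prems by (intro mult_left_mono) auto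
      also have "\<dots> \<le> card (A 0)" using Suc by simp
      finally show ?case .
    qed simp
    have "card (A 0) \<le> card (conf h0)" using conf_fin by (intro card_mono) (auto simp: A_def alive_def)
    also have "\<dots> < 2 ^ D" using cov by (simp add: covers_def)
    finally have "2 ^ D * card (A D) < 2 ^ D" using halving[of D] by linarith
    then have "card (A D) = 0" by simp
    then have AD: "A D = {}" using finA by simp
    show ?thesis
    proof (rule ccontr)
      assume "\<not> ?thesis"
      then obtain x where x: "x \<in> ivl (B (Suc i * D))" "x \<in> Bad h0" by (auto simp: h0_def)
      have "x \<in> ivl (B (i * D))" using x(1) nested_play_subset[OF \<beta> nested, of "i * D" "Suc i * D"] by auto
      then obtain P where P: "P \<in> conf h0" "x \<in> cball P (\<beta> ^ Suc D * R)"
        using cov x unfolding covers_def last_h0 R_def by blast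
      have "\<bar>P - fst (B (i * D + D))\<bar> \<le> snd (B (i * D + D)) + \<beta> ^ Suc D * R"
        using P(2) x(1) by (simp add: ivl_def dist_real_def add.commute)
      then have "P \<in> A D" using P by (simp add: A_def alive_def last_h0 R_def)
      then show False using AD by simp
    qed
  qed
  ultimately show ?thesis by blast
qed

section \<open>Lattice vectors at a point of the half-plane\<close>


text \<open>The norm in coordinates. The constant \<open>K\<close> compares it with the coordinates
  in both directions; positivity and definiteness are contained in \<open>fst_le_N\<close> and
  \<open>snd_le_N\<close>.\<close>

locale plane_norm =
  fixes N :: "real \<Rightarrow> real \<Rightarrow> real" and K :: real
  assumes K_ge_1: "1 \<le> K"
    and N_le: "N a b \<le> K * (\<bar>a\<bar> + \<bar>b\<bar>)"
    and fst_le_N: "\<bar>a\<bar> \<le> K * N a b"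
    and snd_le_N: "\<bar>b\<bar> \<le> K * N a b"
    and N_scale: "N (t * a) (t * b) = \<bar>t\<bar> * N a b"
    and N_triangle: "N (a + a') (b + b') \<le> N a b + N a' b'"
begin

lemma K_pos: "0 < K"
  using K_ge_1 by linarith

text \<open>Convexity in the form needed for moving from \<open>(a', b')\<close> through
  \<open>(a, b)\<close> and a proportion \<open>s\<close> beyond: the point reached plus
  \<open>s\<close> times \<open>(a', b')\<close> is \<open>1 + s\<close> times
  \<open>(a, b)\<close>, and the triangle inequality applies to this sum.\<close>

lemma N_extrapolate:
  assumes "0 \<le> s"
  shows "(1 + s) * N a b - s * N a' b' \<le> N (a + s * (a - a')) (b + s * (b - b'))"
proof -
  have "(1 + s) * N a b = N ((1 + s) * a) ((1 + s) * b)"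
    using assms N_scale[of "1 + s" a b] by simp
  also have "\<dots> = N ((a + s * (a - a')) + s * a') ((b + s * (b - b')) + s * b')"
    by (simp add: algebra_simps)
  also have "\<dots> \<le> N (a + s * (a - a')) (b + s * (b - b')) + N (s * a') (s * b')"
    by (rule N_triangle)
  also have "N (s * a') (s * b') = s * N a' b'"
    using assms N_scale[of s a' b'] by simp
  finally show ?thesis by simp
qed

text \<open>The point \<open>(x, y)\<close> stands for the matrix with rows \<open>(1, x)\<close>
  and \<open>(0, y)\<close>, of determinant \<open>y\<close>. Thus
  \<open>at_point x y v / sqrt y\<close> is the norm of \<open>v\<close> after a map of determinant
  1, which is why lengths are always compared with multiples of \<open>sqrt y\<close>.\<close>

definition at_point :: "real \<Rightarrow> real \<Rightarrow> real \<times> real \<Rightarrow> real" where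
  "at_point x y v = N (fst v + x * snd v) (y * snd v)"

lemma snd_le_at_point:
  assumes "0 < b" "b \<le> y"
  shows "\<bar>snd v\<bar> \<le> K * at_point x y v / b"
proof -
  have "b * \<bar>snd v\<bar> \<le> y * \<bar>snd v\<bar>"
    using assms by (intro mult_right_mono) auto
  also have "\<dots> = \<bar>y * snd v\<bar>" using assms by (simp add: abs_mult)
  also have "\<dots> \<le> K * at_point x y v"
    unfolding at_point_def by (rule snd_le_N)
  finally show ?thesis using assms by (simp add: field_simps)
qed

text \<open>The change is governed by \<open>snd v\<close> times the displacement, and
  \<open>\<bar>snd v\<bar>\<close> is itself at most a multiple of \<open>at_point x y v\<close>;
  hence the error is relative and uniform in \<open>v\<close>.\<close>

lemma at_point_perturb:
  assumes "0 < b" "b \<le> y" "\<bar>X - x\<bar> + \<bar>Y - y\<bar> \<le> d"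
  shows "(1 - K\<^sup>2 * (d / b)) * at_point x y v \<le> at_point X Y v"
proof -
  have "at_point x y v = N ((fst v + X * snd v) + (x - X) * snd v) (Y * snd v + (y - Y) * snd v)"
    by (simp add: at_point_def algebra_simps)
  also have "\<dots> \<le> at_point X Y v + N ((x - X) * snd v) ((y - Y) * snd v)"
    unfolding at_point_def by (rule N_triangle)
  also have "N ((x - X) * snd v) ((y - Y) * snd v) \<le> K * (\<bar>(x - X) * snd v\<bar> + \<bar>(y - Y) * snd v\<bar>)"
    by (rule N_le)
  also have "\<dots> = K * ((\<bar>X - x\<bar> + \<bar>Y - y\<bar>) * \<bar>snd v\<bar>)"
    by (simp only: abs_mult abs_minus_commute[of x X] abs_minus_commute[of y Y] distrib_right)
  also have "\<dots> \<le> K * (d * (K * at_point x y v / b))"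
    using assms snd_le_at_point[OF assms(1,2)] K_pos
    by (intro mult_left_mono mult_mono) auto
  finally show ?thesis by (simp add: algebra_simps power2_eq_square)
qed

text \<open>Disposes at once of the infinitely many vectors that are not almost shortest: the
  relative error of \<open>at_point_perturb\<close> and the growth of the square root consume at
  most half of the margin \<open>\<sigma>\<close>.\<close>

lemma at_point_stays_large:
  assumes "0 < r" "0 < \<sigma>" "\<sigma> \<le> r" "0 < b" "b \<le> y" "0 < Y"
    and d: "\<bar>X - x\<bar> + \<bar>Y - y\<bar> \<le> d" "d \<le> b * \<sigma> / (8 * r * K\<^sup>2)"
    and large: "(r + \<sigma>) * sqrt y < at_point x y v"
  shows "(r + \<sigma> / 2) * sqrt Y \<le> at_point X Y v"
proof -
  define t where "t = d / b"
  have t: "0 \<le> t" using assms abs_ge_zero[of "X - x"] abs_ge_zero[of "Y - y"] unfolding t_def by (intro divide_nonneg_pos) linarith+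
  have K2: "1 \<le> K\<^sup>2" using K_ge_1 by simp
  have "t \<le> \<sigma> / (8 * r * K\<^sup>2)" using d(2) assms unfolding t_def by (simp add: field_simps)
  then have tK: "8 * (r * (K\<^sup>2 * t)) \<le> \<sigma>" using assms K2 K_pos by (simp add: field_simps)
  have tK1: "t \<le> K\<^sup>2 * t" using K2 t mult_right_mono[of 1 "K\<^sup>2" t] by simp
  have rt: "r * t \<le> r * (K\<^sup>2 * t)" using tK1 assms by simp
  have st: "\<sigma> * t \<le> r * t" "\<sigma> * (K\<^sup>2 * t) \<le> r * (K\<^sup>2 * t)"
    using assms t K2 by (auto intro!: mult_right_mono)
  have K2t: "K\<^sup>2 * t \<le> 1"
  proof -
    have "r * (8 * (K\<^sup>2 * t)) \<le> r * 1" using tK assms by linarith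
    then have "8 * (K\<^sup>2 * t) \<le> 1" using assms(1) mult_le_cancel_left_pos[of r "8 * (K\<^sup>2 * t)" 1] by simp
    moreover have "0 \<le> K\<^sup>2 * t" using t by simp
    ultimately show ?thesis by linarith
  qed
  have "Y \<le> y + d" using d(1) by linarith
  also have "\<dots> \<le> y * (1 + t)" using assms t mult_right_mono[of b y t] unfolding t_def by (simp add: algebra_simps)
  also have "\<dots> \<le> y * (1 + t)\<^sup>2" using t assms by (intro mult_left_mono) (auto simp: power2_eq_square algebra_simps)
  finally have "sqrt Y \<le> sqrt (y * (1 + t)\<^sup>2)" by simp
  then have sY: "sqrt Y \<le> sqrt y * (1 + t)" using t by (simp add: real_sqrt_mult)
  have "(r + \<sigma> / 2) * sqrt Y \<le> (r + \<sigma> / 2) * (sqrt y * (1 + t))"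
    using sY assms by (intro mult_left_mono) auto
  also have "\<dots> = ((r + \<sigma> / 2) * (1 + t)) * sqrt y" by simp
  also have "\<dots> \<le> ((1 - K\<^sup>2 * t) * (r + \<sigma>)) * sqrt y"
  proof (intro mult_right_mono)
    show "(r + \<sigma> / 2) * (1 + t) \<le> (1 - K\<^sup>2 * t) * (r + \<sigma>)"
    proof -
      have "(r + \<sigma> / 2) * (1 + t) = r + \<sigma> / 2 + r * t + \<sigma> * t / 2"
        "(1 - K\<^sup>2 * t) * (r + \<sigma>) = r + \<sigma> - r * (K\<^sup>2 * t) - \<sigma> * (K\<^sup>2 * t)"
        by (simp_all add: algebra_simps)
      then show ?thesis using tK rt st assms(2) by linarith
    qed
    show "0 \<le> sqrt y" using assms by simp
  qed
  also have "\<dots> = (1 - K\<^sup>2 * t) * ((r + \<sigma>) * sqrt y)" by simp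
  also have "\<dots> \<le> (1 - K\<^sup>2 * t) * at_point x y v"
    using large K2t by (intro mult_left_mono) auto
  also have "\<dots> \<le> at_point X Y v"
    using at_point_perturb[OF assms(4,5) d(1)] unfolding t_def .
  finally show ?thesis .
qed

text \<open>The norm is extrapolated linearly, while strict concavity keeps the square root of the
  new height below the extrapolated square roots. The surplus is quadratic in the difference of the
  heights and is set against \<open>\<epsilon>\<close> and \<open>\<sigma>\<close>.\<close>

lemma at_point_extrapolate_vertical:
  assumes r: "0 < r" "0 \<le> \<epsilon>" "0 \<le> \<sigma>" and y: "0 < y" "y \<le> 1" "0 < y'" "y' \<le> 1"
    and \<tau>: "0 < \<tau>" "\<tau> \<le> 1" and \<theta>: "0 \<le> \<theta>" "\<theta> \<le> \<bar>y - y'\<bar>"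
    and Y: "0 < y + \<tau> * (y - y')"
    and v: "(r - \<epsilon>) * sqrt y \<le> at_point x y v" "at_point x' y' v \<le> (r + \<sigma>) * sqrt y'"
  shows "r * sqrt (y + \<tau> * (y - y')) + r * \<tau> * \<theta>\<^sup>2 / 16 - 2 * \<epsilon> - \<tau> * \<sigma>
    \<le> at_point (x + \<tau> * (x - x')) (y + \<tau> * (y - y')) v"
proof -
  define a where "a = sqrt y"
  define b where "b = sqrt y'"
  define Y where "Y = y + \<tau> * (y - y')"
  define E where "E = (1 + \<tau>) * a - \<tau> * b"
  have ab: "0 < a" "a \<le> 1" "0 < b" "b \<le> 1" "a\<^sup>2 = y" "b\<^sup>2 = y'"
    using y by (auto simp: a_def b_def)
  \<comment> \<open>The excess over \<open>Y\<close> is the whole gain; dividing it by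
    \<open>E + sqrt Y\<close>, which is at most 4, turns it into a gain for the root itself.\<close>
  have E2: "E\<^sup>2 = Y + \<tau> * (1 + \<tau>) * (a - b)\<^sup>2"
    unfolding E_def Y_def ab(5,6)[symmetric] by (simp add: power2_eq_square algebra_simps)
  have Ypos: "0 < Y" using assms(12) by (simp add: Y_def)
  have "\<bar>y - y'\<bar> = \<bar>a - b\<bar> * (a + b)"
  proof -
    have "y - y' = (a - b) * (a + b)" unfolding ab(5,6)[symmetric] by (simp add: power2_eq_square algebra_simps)
    then show ?thesis using ab by (simp add: abs_mult)
  qed
  also have "\<dots> \<le> \<bar>a - b\<bar> * 2" using ab by (intro mult_left_mono) auto
  finally have "\<theta> / 2 \<le> \<bar>a - b\<bar>" using \<theta> by simp
  then have "(\<theta> / 2)\<^sup>2 \<le> \<bar>a - b\<bar>\<^sup>2" using \<theta> by (intro power_mono) auto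
  then have ab2: "\<theta>\<^sup>2 / 4 \<le> (a - b)\<^sup>2" by (simp add: power_divide)
  have Epos: "0 < E"
  proof -
    have "\<tau> * b\<^sup>2 < (1 + \<tau>) * a\<^sup>2" using Ypos unfolding Y_def ab(5,6)[symmetric] by (simp add: algebra_simps)
    then have "\<tau>\<^sup>2 * b\<^sup>2 < \<tau> * ((1 + \<tau>) * a\<^sup>2)"
      using \<tau> mult_strict_left_mono[of "\<tau> * b\<^sup>2" "(1 + \<tau>) * a\<^sup>2" \<tau>] by (simp add: power2_eq_square mult.assoc)
    also have "\<dots> \<le> (1 + \<tau>) * ((1 + \<tau>) * a\<^sup>2)" using \<tau> by (intro mult_right_mono) auto
    finally have "(\<tau> * b)\<^sup>2 < ((1 + \<tau>) * a)\<^sup>2" by (simp add: power_mult_distrib power2_eq_square algebra_simps)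
    moreover have "0 \<le> (1 + \<tau>) * a" using \<tau> ab by simp
    ultimately have "\<tau> * b < (1 + \<tau>) * a" by (rule power2_less_imp_less)
    then show ?thesis unfolding E_def by simp
  qed
  have Ele: "E \<le> 2"
  proof -
    have "(1 + \<tau>) * a \<le> 2 * 1" using \<tau> ab by (intro mult_mono) auto
    moreover have "0 \<le> \<tau> * b" using \<tau> ab by simp
    ultimately show ?thesis unfolding E_def by linarith
  qed
  have sqY: "sqrt Y \<le> E"
  proof (rule real_le_lsqrt)
    show "Y \<le> E\<^sup>2" using E2 \<tau> by simp
  qed (use Epos in auto)
  have gain: "\<tau> * \<theta>\<^sup>2 / 16 \<le> E - sqrt Y"
  proof -
    have "\<tau> * (\<theta>\<^sup>2 / 4) \<le> \<tau> * (a - b)\<^sup>2" using ab2 \<tau> by (intro mult_left_mono) auto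
    also have "\<dots> \<le> \<tau> * (1 + \<tau>) * (a - b)\<^sup>2" using \<tau> by (intro mult_right_mono) auto
    also have "\<dots> = E\<^sup>2 - (sqrt Y)\<^sup>2" using E2 Ypos by simp
    also have "\<dots> = (E - sqrt Y) * (E + sqrt Y)" by (simp add: power2_eq_square algebra_simps)
    also have "\<dots> \<le> (E - sqrt Y) * 4" using sqY Ele by (intro mult_left_mono) auto
    finally show ?thesis by simp
  qed
  have "r * sqrt Y + r * \<tau> * \<theta>\<^sup>2 / 16 \<le> r * E"
    using mult_left_mono[OF gain, of r] r by (simp add: algebra_simps)
  moreover have "(1 + \<tau>) * (\<epsilon> * a) \<le> 2 * \<epsilon>"
  proof -
    have "(1 + \<tau>) * (\<epsilon> * a) \<le> 2 * (\<epsilon> * 1)" using \<tau> ab r by (intro mult_mono) auto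
    then show ?thesis by simp
  qed
  moreover have "\<tau> * (\<sigma> * b) \<le> \<tau> * \<sigma>"
    using \<tau> ab r by (intro mult_left_mono) (auto simp: mult_left_le)
  moreover have "r * E - (1 + \<tau>) * (\<epsilon> * a) - \<tau> * (\<sigma> * b) \<le> at_point (x + \<tau> * (x - x')) Y v"
  proof -
    have "r * E - (1 + \<tau>) * (\<epsilon> * a) - \<tau> * (\<sigma> * b) = (1 + \<tau>) * ((r - \<epsilon>) * a) - \<tau> * ((r + \<sigma>) * b)"
      by (simp add: E_def algebra_simps)
    also have "\<dots> \<le> (1 + \<tau>) * at_point x y v - \<tau> * at_point x' y' v"
      using v \<tau> by (intro diff_mono mult_left_mono) (auto simp: a_def b_def)
    also have "\<dots> \<le> N ((fst v + x * snd v) + \<tau> * ((fst v + x * snd v) - (fst v + x' * snd v)))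
        (y * snd v + \<tau> * (y * snd v - y' * snd v))"
      unfolding at_point_def using \<tau> by (intro N_extrapolate) auto
    also have "\<dots> = at_point (x + \<tau> * (x - x')) Y v"
      by (simp add: at_point_def Y_def algebra_simps)
    finally show ?thesis .
  qed
  ultimately show ?thesis unfolding Y_def by linarith
qed

text \<open>Nearly equal heights leave no gain from concavity, so the height is also multiplied by
  \<open>1 + \<mu>\<close>. Stretching an extrapolated vector by \<open>1 + \<mu>\<close> gains this
  factor in norm, whereas \<open>sqrt ((1 + \<mu>) * y)\<close> exceeds \<open>sqrt y\<close> at
  most by the factor \<open>1 + \<mu> / 2\<close>. The bound on
  \<open>\<bar>fst v + x * snd v\<bar>\<close> keeps the extrapolation parameter
  nonnegative.\<close>

lemma at_point_extrapolate_horizontal: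
  assumes r: "0 < r" "0 \<le> \<epsilon>" "0 \<le> \<sigma>" and y: "0 < b" "b \<le> y" "y \<le> 1" "b \<le> y'" "y' \<le> 1"
    and \<tau>: "0 < \<tau>" "\<tau> \<le> 1" and \<mu>: "0 < \<mu>" "\<mu> \<le> 1" and "\<bar>y - y'\<bar> \<le> \<theta>"
    and nz: "x \<noteq> x'" "snd v \<noteq> 0"
    and steep: "\<mu> * \<bar>fst v + x * snd v\<bar> \<le> \<tau> / 2 * (\<bar>x - x'\<bar> * \<bar>snd v\<bar>)"
    and snd: "\<bar>snd v\<bar> \<le> 2 * r * K / b"
    and v: "(r - \<epsilon>) * sqrt y \<le> at_point x y v" "at_point x' y' v \<le> (r + \<sigma>) * sqrt y'"
  shows "r * sqrt ((1 + \<mu>) * y) + r * b * \<mu> / 2 - 12 * r * K\<^sup>2 * \<tau> * \<theta> / b - 6 * \<epsilon> - 4 * \<tau> * \<sigma>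
    \<le> at_point (x + \<tau> * (x - x')) ((1 + \<mu>) * y) v"
proof -
  define a where "a = sqrt y"
  define a' where "a' = sqrt y'"
  have b1: "b \<le> 1" using y by linarith
  have bsq: "b \<le> sqrt b"
  proof (rule real_le_rsqrt)
    show "b\<^sup>2 \<le> b" using y b1 by (simp add: power2_eq_square mult_left_le)
  qed
  have ab: "b \<le> a" "a \<le> 1" "b \<le> a'" "a' \<le> 1" "a\<^sup>2 = y" "a'\<^sup>2 = y'"
    using y order_trans[OF bsq real_sqrt_le_mono[OF y(2)]] order_trans[OF bsq real_sqrt_le_mono[OF y(4)]]
    by (auto simp: a_def a'_def)
  have \<theta>: "0 \<le> \<theta>" using assms(13) by linarith
  have diff: "\<bar>a' - a\<bar> \<le> \<theta> / b"
  proof -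
    have "b * \<bar>a' - a\<bar> \<le> (a' + a) * \<bar>a' - a\<bar>" using ab y by (intro mult_right_mono) auto
    also have "\<dots> = \<bar>y' - y\<bar>"
    proof -
      have "y' - y = (a' + a) * (a' - a)" unfolding ab(5,6)[symmetric] by (simp add: power2_eq_square algebra_simps)
      moreover have "\<bar>a' + a\<bar> = a' + a" using ab y by linarith
      ultimately show ?thesis by (simp add: abs_mult)
    qed
    also have "\<dots> \<le> \<theta>" using assms(13) by linarith
    finally show ?thesis using y by (simp add: field_simps)
  qed
  \<comment> \<open>The parameter \<open>s\<close> is chosen so that stretching the extrapolated
    vector by \<open>1 + \<mu>\<close> gives exactly the first coordinate of \<open>v\<close> at the
    new point; the second coordinate is then off only by a term with the factor
    \<open>y - y'\<close>.\<close>
  define g where "g = (fst v + x * snd v) / ((x - x') * snd v)"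
  define s where "s = (\<tau> - \<mu> * g) / (1 + \<mu>)"
  have den: "(x - x') * snd v \<noteq> 0" using nz by simp
  have "\<mu> * \<bar>g\<bar> \<le> \<tau> / 2"
    using steep den nz \<mu> unfolding g_def by (simp add: abs_mult divide_simps)
  then have "\<bar>\<mu> * g\<bar> \<le> \<tau> / 2" using \<mu> by (simp add: abs_mult)
  then have sg: "0 \<le> \<tau> - \<mu> * g" "\<tau> - \<mu> * g \<le> 2 * \<tau>" using \<tau> by auto
  have s0: "0 \<le> s" using sg \<mu> unfolding s_def by simp
  have s1: "s \<le> 2 * \<tau>"
  proof -
    have "\<tau> - \<mu> * g \<le> 2 * \<tau> * (1 + \<mu>)" 
    proof -
      have "2 * \<tau> * (1 + \<mu>) = 2 * \<tau> + 2 * (\<tau> * \<mu>)" by (simp add: algebra_simps)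
      then show ?thesis using sg mult_pos_pos[OF \<tau>(1) \<mu>(1)] by linarith
    qed
    then show ?thesis using \<mu> unfolding s_def by (simp add: pos_divide_le_eq)
  qed
  have seq: "(1 + \<mu>) * s = \<tau> - \<mu> * g" using \<mu> unfolding s_def by simp
  have geq: "g * ((x - x') * snd v) = fst v + x * snd v" using den unfolding g_def by simp
  define e where "e = (1 + \<mu>) * (snd v * s * (y - y'))"
  have first: "(1 + \<mu>) * ((fst v + x * snd v) + s * ((fst v + x * snd v) - (fst v + x' * snd v)))
      = fst v + (x + \<tau> * (x - x')) * snd v"
  proof -
    have "(1 + \<mu>) * ((fst v + x * snd v) + s * ((fst v + x * snd v) - (fst v + x' * snd v)))
      = (1 + \<mu>) * (fst v + x * snd v) + ((1 + \<mu>) * s) * ((x - x') * snd v)"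
      by (simp add: algebra_simps)
    also have "\<dots> = (1 + \<mu>) * (fst v + x * snd v) + \<tau> * ((x - x') * snd v) - \<mu> * (g * ((x - x') * snd v))"
      unfolding seq by (simp add: algebra_simps)
    also have "\<dots> = fst v + (x + \<tau> * (x - x')) * snd v"
      unfolding geq by (simp add: algebra_simps)
    finally show ?thesis .
  qed
  have second: "(1 + \<mu>) * (y * snd v + s * (y * snd v - y' * snd v)) = (1 + \<mu>) * y * snd v + e"
    unfolding e_def by (simp add: algebra_simps)
  have err: "N 0 e \<le> 8 * r * K\<^sup>2 * \<tau> * \<theta> / b"
  proof -
    have "\<bar>e\<bar> = (1 + \<mu>) * (\<bar>snd v\<bar> * s * \<bar>y - y'\<bar>)" using \<mu> s0 by (simp add: e_def abs_mult)
    also have "\<dots> \<le> 2 * ((2 * r * K / b) * (2 * \<tau>) * \<theta>)"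
      using \<mu> snd s0 s1 assms(13) \<theta> r K_pos y \<tau> by (intro mult_mono) auto
    finally have "K * \<bar>e\<bar> \<le> K * (2 * ((2 * r * K / b) * (2 * \<tau>) * \<theta>))" using K_pos by (intro mult_left_mono) auto
    then show ?thesis using N_le[of 0 e] by (simp add: power2_eq_square algebra_simps)
  qed
  have main: "(1 + \<mu>) * ((1 + s) * at_point x y v - s * at_point x' y' v) - N 0 e
      \<le> at_point (x + \<tau> * (x - x')) ((1 + \<mu>) * y) v"
  proof -
    have "(1 + \<mu>) * ((1 + s) * at_point x y v - s * at_point x' y' v)
      \<le> (1 + \<mu>) * N ((fst v + x * snd v) + s * ((fst v + x * snd v) - (fst v + x' * snd v)))
        (y * snd v + s * (y * snd v - y' * snd v))"
      unfolding at_point_def using \<mu> s0 by (intro mult_left_mono N_extrapolate) auto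
    also have "\<dots> = N (fst v + (x + \<tau> * (x - x')) * snd v + 0) ((1 + \<mu>) * y * snd v + e)"
      unfolding first[symmetric] second[symmetric] using \<mu> by (simp add: N_scale)
    also have "\<dots> \<le> at_point (x + \<tau> * (x - x')) ((1 + \<mu>) * y) v + N 0 e"
      unfolding at_point_def by (rule N_triangle)
    finally show ?thesis by simp
  qed
  have lower: "r * a - 2 * \<tau> * r * \<theta> / b - 3 * \<epsilon> - 2 * \<tau> * \<sigma> \<le> (1 + s) * at_point x y v - s * at_point x' y' v"
  proof -
    have "(1 + s) * at_point x y v - s * at_point x' y' v \<ge> (1 + s) * ((r - \<epsilon>) * a) - s * ((r + \<sigma>) * a')"
      using v s0 by (intro diff_mono mult_left_mono) (auto simp: a_def a'_def)
    moreover have "(1 + s) * ((r - \<epsilon>) * a) - s * ((r + \<sigma>) * a')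
      = r * a - s * r * (a' - a) - (1 + s) * (\<epsilon> * a) - s * (\<sigma> * a')" by (simp add: algebra_simps)
    moreover have "s * r * (a' - a) \<le> 2 * \<tau> * r * (\<theta> / b)"
    proof -
      have "s * r * (a' - a) \<le> s * r * (\<theta> / b)" using diff s0 r by (intro mult_left_mono) auto
      also have "\<dots> \<le> 2 * \<tau> * r * (\<theta> / b)" using s1 r \<theta> y by (intro mult_right_mono) auto
      finally show ?thesis .
    qed
    moreover have "(1 + s) * (\<epsilon> * a) \<le> 3 * \<epsilon>"
    proof -
      have "(1 + s) * (\<epsilon> * a) \<le> 3 * (\<epsilon> * 1)" using s0 s1 \<tau> ab r y by (intro mult_mono) auto
      then show ?thesis by simp
    qed
    moreover have "s * (\<sigma> * a') \<le> 2 * \<tau> * \<sigma>"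
    proof -
      have "s * (\<sigma> * a') \<le> (2 * \<tau>) * (\<sigma> * 1)" using s0 s1 \<tau> ab r y by (intro mult_mono) auto
      then show ?thesis by simp
    qed
    ultimately show ?thesis by simp
  qed
  \<comment> \<open>The losses before stretching; the factor \<open>1 + \<mu>\<close> at most
    doubles them.\<close>
  define T where "T = 2 * \<tau> * r * \<theta> / b + 3 * \<epsilon> + 2 * \<tau> * \<sigma>"
  have T: "0 \<le> T" unfolding T_def using \<tau> r \<theta> y by simp
  have "(1 + \<mu>) * (r * a) - 2 * T \<le> (1 + \<mu>) * (r * a - T)"
    using mult_right_mono[of \<mu> 1 T] \<mu> T by (simp add: algebra_simps)
  also have "\<dots> \<le> (1 + \<mu>) * ((1 + s) * at_point x y v - s * at_point x' y' v)"
    using lower \<mu> unfolding T_def by (intro mult_left_mono) auto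
  finally have B: "(1 + \<mu>) * (r * a) - 2 * T - N 0 e \<le> at_point (x + \<tau> * (x - x')) ((1 + \<mu>) * y) v"
    using main by linarith
  have sq: "sqrt ((1 + \<mu>) * y) \<le> (1 + \<mu> / 2) * a"
  proof -
    have "sqrt (1 + \<mu>) \<le> 1 + \<mu> / 2" using \<mu>
      by (intro real_le_lsqrt) (auto simp: power2_eq_square algebra_simps)
    then show ?thesis using ab y unfolding a_def real_sqrt_mult by (intro mult_right_mono) auto
  qed
  have "r * sqrt ((1 + \<mu>) * y) + r * b * \<mu> / 2 \<le> r * ((1 + \<mu> / 2) * a) + r * a * \<mu> / 2"
    using sq r ab \<mu> by (intro add_mono mult_left_mono divide_right_mono mult_right_mono) auto
  also have "\<dots> = (1 + \<mu>) * (r * a)" by (simp add: algebra_simps)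
  finally have C: "r * sqrt ((1 + \<mu>) * y) + r * b * \<mu> / 2 \<le> (1 + \<mu>) * (r * a)" .
  define V where "V = \<tau> * r * \<theta> / b"
  define W where "W = r * K\<^sup>2 * \<tau> * \<theta> / b"
  have "V \<le> W"
  proof -
    have "1 \<le> K\<^sup>2" using K_ge_1 by simp
    then have "V * 1 \<le> V * K\<^sup>2" using \<tau> r \<theta> y unfolding V_def by (intro mult_left_mono) auto
    then show ?thesis by (simp add: V_def W_def algebra_simps)
  qed
  moreover have "T = 2 * V + 3 * \<epsilon> + 2 * \<tau> * \<sigma>" by (simp add: T_def V_def)
  moreover have "N 0 e \<le> 8 * W" using err by (simp add: W_def)
  moreover have "12 * r * K\<^sup>2 * \<tau> * \<theta> / b = 12 * W" by (simp add: W_def)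
  ultimately show ?thesis using B C by linarith
qed

end

text \<open>A separated subset of greatest cardinality serves as \<open>C\<close>: a point outside
  all the balls could be added to it.\<close>

lemma maximal_separated_cover:
  fixes X :: "real set"
  assumes bound: "\<And>F. finite F \<Longrightarrow> F \<subseteq> X \<Longrightarrow> (\<forall>x\<in>F. \<forall>x'\<in>F. x \<noteq> x' \<longrightarrow> \<delta> \<le> \<bar>x - x'\<bar>) \<Longrightarrow> card F \<le> n"
    and "0 \<le> \<delta>"
  shows "\<exists>C. finite C \<and> card C \<le> n \<and> X \<subseteq> (\<Union>P\<in>C. cball P \<delta>)"
proof -
  define sep where "sep F \<longleftrightarrow> finite F \<and> F \<subseteq> X \<and> (\<forall>x\<in>F. \<forall>x'\<in>F. x \<noteq> x' \<longrightarrow> \<delta> \<le> \<bar>x - x'\<bar>)" for F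
  have "sep {}" by (simp add: sep_def)
  moreover have "\<forall>F. sep F \<longrightarrow> card F \<le> n" using bound by (auto simp: sep_def)
  ultimately obtain F where F: "sep F" and max: "\<And>F'. sep F' \<Longrightarrow> card F' \<le> card F"
    using ex_has_greatest_nat[of sep "{}" card "Suc n"] by (auto simp: less_Suc_eq_le)
  have "X \<subseteq> (\<Union>P\<in>F. cball P \<delta>)"
  proof
    fix x assume x: "x \<in> X"
    show "x \<in> (\<Union>P\<in>F. cball P \<delta>)"
    proof (rule ccontr)
      assume "x \<notin> (\<Union>P\<in>F. cball P \<delta>)"
      then have far: "\<And>P. P \<in> F \<Longrightarrow> \<delta> < \<bar>P - x\<bar>" by (auto simp: dist_real_def not_le)
      then have "x \<notin> F" using assms(2) by fastforce
      moreover have "sep (insert x F)"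
        using F x far less_imp_le by (auto simp: sep_def abs_minus_commute)
      ultimately show False using max[of "insert x F"] F by (simp add: sep_def)
    qed
  qed
  then show ?thesis using F bound by (auto simp: sep_def)
qed

section \<open>Almost shortest vectors and the number of separated bad points\<close>

context plane_norm
begin

definition near :: "(real \<times> real) set \<Rightarrow> real \<Rightarrow> real \<Rightarrow> real \<Rightarrow> (real \<times> real) set" where
  "near \<Lambda> s x y = {v \<in> \<Lambda>. v \<noteq> 0 \<and> at_point x y v \<le> s * sqrt y}"

definition admissible :: "(real \<times> real) set \<Rightarrow> real \<Rightarrow> real \<Rightarrow> real \<Rightarrow> bool" where
  "admissible \<Lambda> s x y \<longleftrightarrow> (\<forall>v\<in>\<Lambda>. v \<noteq> 0 \<longrightarrow> s * sqrt y \<le> at_point x y v)"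

text \<open>The form in which the critical covolume enters: the first minimum of the transformed
  lattice, normalised by \<open>sqrt y\<close>, never exceeds \<open>r\<close>. Lattices of covolume
  1 have this property for \<open>r = 1 / sqrt \<Delta>\<close>.\<close>

definition minima_bounded :: "real \<Rightarrow> (real \<times> real) set \<Rightarrow> bool" where
  "minima_bounded r \<Lambda> \<longleftrightarrow> (\<forall>x y s. 0 < y \<longrightarrow> admissible \<Lambda> s x y \<longrightarrow> s \<le> r)"

lemma near_bounds:
  assumes "0 < r" "0 < b" "b \<le> y" "y \<le> 1" "v \<in> near \<Lambda> (2 * r) x y"
  shows "\<bar>fst v + x * snd v\<bar> \<le> 2 * r * K" "\<bar>snd v\<bar> \<le> 2 * r * K / b"
proof -
  have "2 * r * sqrt y \<le> 2 * r" using assms by (simp add: mult_left_le)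
  then have a: "at_point x y v \<le> 2 * r" using assms(5) by (simp add: near_def)
  then have Ka: "K * at_point x y v \<le> 2 * r * K" using K_pos by simp
  then show "\<bar>fst v + x * snd v\<bar> \<le> 2 * r * K"
    using fst_le_N[of "fst v + x * snd v" "y * snd v"] by (simp add: at_point_def)
  show "\<bar>snd v\<bar> \<le> 2 * r * K / b"
    using snd_le_at_point[OF assms(2,3), of v x] Ka assms(2) by (smt (verit) divide_right_mono)
qed

text \<open>In the coordinates \<open>(x, y)\<close> the region where a fixed lattice vector is shorter than \<open>r\<close> is
  convex, because its norm is convex and \<open>sqrt y\<close> is concave. If every vector that is almost
  shortest at \<open>(x, y)\<close> were almost shortest at \<open>(x', y')\<close> too, then moving from \<open>(x, y)\<close> slightly away
  from \<open>(x', y')\<close> would make all lattice vectors longer than \<open>r\<close>. When \<open>y\<close> and \<open>y'\<close> nearly agree the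
  concavity of \<open>sqrt\<close> is of no use; then \<open>y\<close> is increased instead, which lengthens every vector
  that is not nearly horizontal.\<close>

lemma near_not_subset:
  assumes r: "0 < r" and b: "0 < b" "b \<le> 1" and \<delta>: "0 < \<delta>" and \<eta>: "0 < \<eta>"
  obtains \<epsilon> \<sigma> where "0 < \<epsilon>" "\<epsilon> \<le> r / 2" "0 < \<sigma>" "\<sigma> \<le> r"
    "\<And>\<Lambda> x y x' y'. \<lbrakk>minima_bounded r \<Lambda>; \<bar>x\<bar> \<le> 1; \<bar>x'\<bar> \<le> 1; b \<le> y; y \<le> 1; b \<le> y'; y' \<le> 1;
       \<delta> \<le> \<bar>x - x'\<bar>; admissible \<Lambda> (r - \<epsilon>) x y; \<forall>v \<in> near \<Lambda> (2 * r) x y. \<eta> \<le> \<bar>snd v\<bar>\<rbrakk>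
      \<Longrightarrow> \<not> near \<Lambda> (r + \<sigma>) x y \<subseteq> near \<Lambda> (r + \<sigma>) x' y'"
proof -
  \<comment> \<open>With \<open>c\<close>, the choice \<open>\<mu> = c * \<tau>\<close> meets the
    steepness assumption of \<open>at_point_extrapolate_horizontal\<close>. The bound on
    \<open>\<tau>\<close> is the displacement that \<open>at_point_stays_large\<close> permits. The
    values of \<open>\<theta>\<close>, \<open>\<sigma>\<close> and \<open>\<epsilon>\<close> make
    the losses take at most three quarters of the gain, in the vertical as in the horizontal case;
    \<open>\<epsilon>\<close> depends on all the others and comes last.\<close>
  define c where "c = min 1 (\<delta> * \<eta> / (4 * r * K))"
  define \<theta> where "\<theta> = b\<^sup>2 * c / (96 * K\<^sup>2)"
  define \<sigma> where "\<sigma> = min r (min (r * \<theta>\<^sup>2 / 64) (r * b * c / 32))"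
  define \<tau> where "\<tau> = b * \<sigma> / (32 * r * K\<^sup>2)"
  define \<mu> where "\<mu> = c * \<tau>"
  define \<epsilon> where "\<epsilon> = min (r / 2) (min (r * \<tau> * \<theta>\<^sup>2 / 64) (r * b * \<mu> / 48))"
  have c: "0 < c" "c \<le> 1" "c * (4 * r * K) \<le> \<delta> * \<eta>"
  proof -
    show "0 < c" "c \<le> 1" using \<delta> \<eta> r K_pos by (auto simp: c_def)
    have "c \<le> \<delta> * \<eta> / (4 * r * K)" by (simp add: c_def)
    then show "c * (4 * r * K) \<le> \<delta> * \<eta>" using r K_pos by (simp add: pos_le_divide_eq)
  qed
  have K2: "1 \<le> K\<^sup>2" using K_ge_1 by simp
  have \<theta>: "0 < \<theta>" using b c K_pos by (simp add: \<theta>_def)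
  have \<sigma>: "0 < \<sigma>" "\<sigma> \<le> r" "\<sigma> \<le> r * \<theta>\<^sup>2 / 64" "\<sigma> \<le> r * b * c / 32"
    using r \<theta> b c by (auto simp: \<sigma>_def)
  have \<tau>: "0 < \<tau>" "\<tau> \<le> b / 32"
  proof -
    show "0 < \<tau>" using b \<sigma> r K_pos by (simp add: \<tau>_def)
    have "b * \<sigma> \<le> b * (r * K\<^sup>2)" using b \<sigma> r K2 mult_left_mono[OF K2, of r] by (intro mult_left_mono) linarith+
    then show "\<tau> \<le> b / 32" using r K_pos by (simp add: \<tau>_def field_simps)
  qed
  have \<tau>4: "4 * \<tau> \<le> b * \<sigma> / (8 * r * K\<^sup>2)" using r K_pos by (simp add: \<tau>_def field_simps)
  have \<tau>1: "\<tau> \<le> 1" using \<tau> b by simp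
  have \<mu>: "0 < \<mu>" "\<mu> \<le> \<tau>" using c \<tau> by (auto simp: \<mu>_def mult_left_le_one_le)
  have \<epsilon>: "0 < \<epsilon>" "\<epsilon> \<le> r / 2" "\<epsilon> \<le> r * \<tau> * \<theta>\<^sup>2 / 64" "\<epsilon> \<le> r * b * \<mu> / 48"
    using r \<theta> \<tau> b \<mu> by (auto simp: \<epsilon>_def)
  have "\<not> near \<Lambda> (r + \<sigma>) x y \<subseteq> near \<Lambda> (r + \<sigma>) x' y'"
    if min: "minima_bounded r \<Lambda>" and x: "\<bar>x\<bar> \<le> 1" "\<bar>x'\<bar> \<le> 1" and y: "b \<le> y" "y \<le> 1" "b \<le> y'" "y' \<le> 1"
      and sep: "\<delta> \<le> \<bar>x - x'\<bar>" and adm: "admissible \<Lambda> (r - \<epsilon>) x y"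
      and steep: "\<forall>v \<in> near \<Lambda> (2 * r) x y. \<eta> \<le> \<bar>snd v\<bar>" for \<Lambda> x y x' y'
  proof
    assume sub: "near \<Lambda> (r + \<sigma>) x y \<subseteq> near \<Lambda> (r + \<sigma>) x' y'"
    have x2: "\<bar>x - x'\<bar> \<le> 2" using x by linarith
    have y1: "\<bar>y - y'\<bar> \<le> 1" using y b by linarith
    \<comment> \<open>It suffices to find a point close to \<open>(x, y)\<close> where the almost
      shortest vectors have length at least \<open>r * sqrt Y\<close> plus a margin: the other
      vectors stay long by \<open>at_point_stays_large\<close>, so the normalised minimum there
      would exceed \<open>r\<close>.\<close>
    have contradiction: False
      if Y: "0 < Y" "Y \<le> 4" and XY: "\<bar>X - x\<bar> + \<bar>Y - y\<bar> \<le> 4 * \<tau>" and \<kappa>: "0 < \<kappa>"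
        and close: "\<And>v. v \<in> near \<Lambda> (r + \<sigma>) x y \<Longrightarrow> r * sqrt Y + \<kappa> \<le> at_point X Y v" for X Y \<kappa>
    proof -
      define \<rho> where "\<rho> = min (\<sigma> / 2) (\<kappa> / 2)"
      have "admissible \<Lambda> (r + \<rho>) X Y"
        unfolding admissible_def
      proof (intro ballI impI)
        fix v assume v: "v \<in> \<Lambda>" "v \<noteq> 0"
        show "(r + \<rho>) * sqrt Y \<le> at_point X Y v"
        proof (cases "v \<in> near \<Lambda> (r + \<sigma>) x y")
          case True
          have "\<rho> * sqrt Y \<le> \<kappa> / 2 * 2"
            using Y \<kappa> real_sqrt_le_mono[of Y 4] by (intro mult_mono) (auto simp: \<rho>_def)
          then show ?thesis using close[OF True] by (simp add: algebra_simps)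
        next
          case False
          then have "(r + \<sigma>) * sqrt y < at_point x y v" using v by (simp add: near_def)
          then have "(r + \<sigma> / 2) * sqrt Y \<le> at_point X Y v"
            using r \<sigma> b y Y XY \<tau>4 by (intro at_point_stays_large[of r \<sigma> b y Y X x "4 * \<tau>"]) auto
          moreover have "(r + \<rho>) * sqrt Y \<le> (r + \<sigma> / 2) * sqrt Y"
            using Y by (intro mult_right_mono) (auto simp: \<rho>_def)
          ultimately show ?thesis by linarith
        qed
      qed
      then have "r + \<rho> \<le> r" using min Y unfolding minima_bounded_def by blast
      then show False using \<sigma> \<kappa> by (simp add: \<rho>_def)
    qed
    have nearD: "(r - \<epsilon>) * sqrt y \<le> at_point x y v" "at_point x' y' v \<le> (r + \<sigma>) * sqrt y'"
      "v \<in> near \<Lambda> (2 * r) x y"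
      if "v \<in> near \<Lambda> (r + \<sigma>) x y" for v
    proof -
      show "(r - \<epsilon>) * sqrt y \<le> at_point x y v" using adm that by (simp add: admissible_def near_def)
      show "at_point x' y' v \<le> (r + \<sigma>) * sqrt y'" using sub that by (auto simp: near_def)
      have "(r + \<sigma>) * sqrt y \<le> (2 * r) * sqrt y" using \<sigma> y b by (intro mult_right_mono) auto
      then show "v \<in> near \<Lambda> (2 * r) x y" using that by (auto simp: near_def)
    qed
    show False
    proof (cases "\<theta> \<le> \<bar>y - y'\<bar>")
      case True
      define Y where "Y = y + \<tau> * (y - y')"
      have \<tau>y: "\<bar>\<tau> * (y - y')\<bar> \<le> \<tau>" using y1 \<tau> by (simp add: abs_mult mult_left_le)
      have \<tau>x: "\<bar>\<tau> * (x - x')\<bar> \<le> 2 * \<tau>" using mult_left_mono[OF x2, of \<tau>] \<tau> by (simp add: abs_mult)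
      show False
      proof (rule contradiction[of Y "x + \<tau> * (x - x')" "r * \<tau> * \<theta>\<^sup>2 / 64"])
        show Ypos: "0 < Y" using \<tau>y \<tau> y b unfolding Y_def by linarith
        show "Y \<le> 4" using \<tau>y \<tau>1 y unfolding Y_def by linarith
        show "\<bar>x + \<tau> * (x - x') - x\<bar> + \<bar>Y - y\<bar> \<le> 4 * \<tau>" using \<tau>x \<tau>y \<tau> unfolding Y_def by simp
        show "0 < r * \<tau> * \<theta>\<^sup>2 / 64" using r \<tau> \<theta> by simp
        fix v assume v: "v \<in> near \<Lambda> (r + \<sigma>) x y"
        have "r * sqrt Y + r * \<tau> * \<theta>\<^sup>2 / 16 - 2 * \<epsilon> - \<tau> * \<sigma> \<le> at_point (x + \<tau> * (x - x')) Y v"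
          unfolding Y_def
          by (rule at_point_extrapolate_vertical)
            (use r \<epsilon> \<sigma> y b \<tau> \<tau>1 \<theta> True Ypos nearD[OF v] in \<open>auto simp: Y_def\<close>)
        moreover have "\<tau> * \<sigma> \<le> r * \<tau> * \<theta>\<^sup>2 / 64" using mult_left_mono[OF \<sigma>(3), of \<tau>] \<tau> by (simp add: algebra_simps)
        ultimately show "r * sqrt Y + r * \<tau> * \<theta>\<^sup>2 / 64 \<le> at_point (x + \<tau> * (x - x')) Y v"
          using \<epsilon>(3) by linarith
      qed
    next
      case False
      define Y where "Y = (1 + \<mu>) * y"
      have \<mu>y: "0 < \<mu> * y" "\<mu> * y \<le> \<tau>" using \<mu> y b mult_mono[of \<mu> \<tau> y 1] by auto
      have \<tau>x: "\<bar>\<tau> * (x - x')\<bar> \<le> 2 * \<tau>" using mult_left_mono[OF x2, of \<tau>] \<tau> by (simp add: abs_mult)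
      show False
      proof (rule contradiction[of Y "x + \<tau> * (x - x')" "r * b * \<mu> / 8"])
        show "0 < Y" using \<mu> y b unfolding Y_def by simp
        show "Y \<le> 4" using \<mu>y \<tau>1 y unfolding Y_def by (simp add: algebra_simps)
        show "\<bar>x + \<tau> * (x - x') - x\<bar> + \<bar>Y - y\<bar> \<le> 4 * \<tau>" using \<tau>x \<mu>y \<tau> unfolding Y_def by (simp add: algebra_simps)
        show "0 < r * b * \<mu> / 8" using r b \<mu> by simp
        fix v assume v: "v \<in> near \<Lambda> (r + \<sigma>) x y"
        note v2 = near_bounds[OF r b(1) y(1,2) nearD(3)[OF v]]
        have \<eta>v: "\<eta> \<le> \<bar>snd v\<bar>" using steep nearD(3)[OF v] by blast
        have "\<mu> * \<bar>fst v + x * snd v\<bar> \<le> \<mu> * (2 * r * K)" using v2 \<mu> by (intro mult_left_mono) auto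
        also have "\<dots> = \<tau> / 2 * (c * (4 * r * K))" by (simp add: \<mu>_def)
        also have "\<dots> \<le> \<tau> / 2 * (\<delta> * \<eta>)" using c(3) \<tau> by (intro mult_left_mono) auto
        also have "\<dots> \<le> \<tau> / 2 * (\<bar>x - x'\<bar> * \<bar>snd v\<bar>)"
          using sep \<eta>v \<delta> \<eta> \<tau> by (intro mult_left_mono mult_mono) auto
        finally have st: "\<mu> * \<bar>fst v + x * snd v\<bar> \<le> \<tau> / 2 * (\<bar>x - x'\<bar> * \<bar>snd v\<bar>)" .
        have "r * sqrt Y + r * b * \<mu> / 2 - 12 * r * K\<^sup>2 * \<tau> * \<theta> / b - 6 * \<epsilon> - 4 * \<tau> * \<sigma>
            \<le> at_point (x + \<tau> * (x - x')) Y v"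
          unfolding Y_def
        proof (rule at_point_extrapolate_horizontal[where y' = y'])
          show "0 \<le> \<epsilon>" "0 \<le> \<sigma>" "\<mu> \<le> 1" "\<bar>y - y'\<bar> \<le> \<theta>" using \<epsilon> \<sigma> \<mu> \<tau>1 False by linarith+
          show "x \<noteq> x'" using sep \<delta> by auto
          show "snd v \<noteq> 0" using \<eta> \<eta>v by auto
        qed (fact r b y \<tau>(1) \<tau>1 \<mu>(1) st v2(2) nearD(1)[OF v] nearD(2)[OF v])+
        moreover have "12 * r * K\<^sup>2 * \<tau> * \<theta> / b = r * b * \<mu> / 8"
          using b K_pos by (simp add: \<theta>_def \<mu>_def power2_eq_square field_simps)
        moreover have "4 * \<tau> * \<sigma> \<le> r * b * \<mu> / 8"
          using mult_left_mono[OF \<sigma>(4), of "4 * \<tau>"] \<tau> by (simp add: \<mu>_def algebra_simps)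
        ultimately show "r * sqrt Y + r * b * \<mu> / 8 \<le> at_point (x + \<tau> * (x - x')) Y v"
          using \<epsilon>(4) by linarith
      qed
    qed
  qed
  then show ?thesis using that[of \<epsilon> \<sigma>] \<epsilon> \<sigma> by blast
qed

text \<open>Admissibility at a single point bounds the nonzero vectors from below and so separates
  the lattice. All vectors in question lie in a fixed square, and \<open>M\<close> is the number of
  cells of a grid, independent of the lattice and of the point.\<close>

lemma card_near_vectors:
  assumes r: "0 < r" and b: "0 < b" "b \<le> 1"
  obtains M where "\<And>\<Lambda> x0 y0. \<lbrakk>\<And>u v. u \<in> \<Lambda> \<Longrightarrow> v \<in> \<Lambda> \<Longrightarrow> u - v \<in> \<Lambda>; \<bar>x0\<bar> \<le> 1; b \<le> y0; y0 \<le> 1;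
      admissible \<Lambda> (r / 2) x0 y0\<rbrakk>
    \<Longrightarrow> finite (\<Union>x\<in>{-1..1}. \<Union>y\<in>{b..1}. near \<Lambda> (2 * r) x y) \<and>
      card (\<Union>x\<in>{-1..1}. \<Union>y\<in>{b..1}. near \<Lambda> (2 * r) x y) \<le> M"
proof -
  \<comment> \<open>As \<open>K * (3 * h)\<close> is \<open>r / 2 * b\<close>, two vectors in one
    cell of side \<open>h\<close> would differ by a lattice vector shorter than admissibility at
    \<open>(x0, y0)\<close> allows.\<close>
  define h where "h = r * b / (6 * K)"
  define C where "C = 4 * r * K / b"
  define L where "L = \<lceil>C / h\<rceil> + 1"
  define G where "G = {-L..L} \<times> {-L..L}"
  have h: "0 < h" using r b K_pos by (simp add: h_def)
  have "finite V \<and> card V \<le> card G"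
    if sub: "\<And>u v. u \<in> \<Lambda> \<Longrightarrow> v \<in> \<Lambda> \<Longrightarrow> u - v \<in> \<Lambda>" and x0: "\<bar>x0\<bar> \<le> 1" and y0: "b \<le> y0" "y0 \<le> 1"
      and adm: "admissible \<Lambda> (r / 2) x0 y0" and V: "V = (\<Union>x\<in>{-1..1}. \<Union>y\<in>{b..1}. near \<Lambda> (2 * r) x y)"
    for \<Lambda> x0 y0 V
  proof -
    define f where "f v = (\<lfloor>fst v / h\<rfloor>, \<lfloor>snd v / h\<rfloor>)" for v :: "real \<times> real"
    have inj: "inj_on f V"
    proof (rule inj_onI, rule ccontr)
      fix u v assume uv: "u \<in> V" "v \<in> V" "f u = f v" "u \<noteq> v"
      define w where "w = u - v"
      have w: "w \<in> \<Lambda>" "w \<noteq> 0" using uv sub by (auto simp: w_def V near_def)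
      have close: "\<bar>s - t\<bar> < h" if "\<lfloor>s / h\<rfloor> = \<lfloor>t / h\<rfloor>" for s t
      proof -
        have "\<bar>s / h - t / h\<bar> < 1" using that by linarith
        then have "\<bar>(s - t) / h\<bar> < 1" by (simp add: diff_divide_distrib)
        then show ?thesis using h by (simp add: abs_divide)
      qed
      have fw: "\<bar>fst w\<bar> < h" "\<bar>snd w\<bar> < h" using uv(3) close by (auto simp: f_def w_def)
      have "\<bar>x0 * snd w\<bar> \<le> \<bar>snd w\<bar>" "\<bar>y0 * snd w\<bar> \<le> \<bar>snd w\<bar>"
        using x0 y0 b by (auto simp: abs_mult intro!: mult_left_le_one_le)
      then have "\<bar>fst w + x0 * snd w\<bar> + \<bar>y0 * snd w\<bar> < 3 * h" using fw by linarith
      then have "K * (\<bar>fst w + x0 * snd w\<bar> + \<bar>y0 * snd w\<bar>) < K * (3 * h)" using K_pos by simp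
      then have "at_point x0 y0 w < K * (3 * h)" using N_le unfolding at_point_def by (rule le_less_trans[rotated])
      also have "\<dots> = r / 2 * b" using K_pos by (simp add: h_def)
      also have "\<dots> \<le> r / 2 * sqrt y0"
      proof -
        have "b\<^sup>2 \<le> b" using b by (simp add: power2_eq_square mult_left_le)
        then have "b \<le> sqrt y0" using y0 by (intro real_le_rsqrt) linarith
        then show ?thesis using r by simp
      qed
      finally show False using adm w by (force simp: admissible_def)
    qed
    have "f ` V \<subseteq> G"
    proof
      fix g assume "g \<in> f ` V"
      then obtain v x y where v: "g = f v" "\<bar>x\<bar> \<le> 1" "b \<le> y" "y \<le> 1" "v \<in> near \<Lambda> (2 * r) x y"
        by (auto simp: V abs_le_iff)
      note bd = near_bounds[OF r b(1) v(3,4,5)]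
      have "2 * r * K \<le> 2 * r * K / b" using r K_pos b by (simp add: pos_le_divide_eq mult_left_le)
      moreover have "\<bar>x * snd v\<bar> \<le> \<bar>snd v\<bar>" using v(2) by (auto simp: abs_mult intro!: mult_left_le_one_le)
      moreover have "2 * r * K / b \<le> C" using r K_pos b by (simp add: C_def divide_right_mono)
      moreover have "C = 2 * r * K / b + 2 * r * K / b" by (simp add: C_def)
      ultimately have "\<bar>fst v\<bar> \<le> C" using bd by linarith
      moreover have "\<bar>snd v\<bar> \<le> C" using bd(2) \<open>2 * r * K / b \<le> C\<close> by (rule order_trans)
      ultimately have "\<bar>fst v / h\<bar> \<le> C / h" "\<bar>snd v / h\<bar> \<le> C / h" using h by (auto simp: abs_divide divide_right_mono)
      then have "\<bar>\<lfloor>fst v / h\<rfloor>\<bar> \<le> L" "\<bar>\<lfloor>snd v / h\<rfloor>\<bar> \<le> L" unfolding L_def by linarith+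
      then show "g \<in> G" by (auto simp: v(1) f_def G_def)
    qed
    moreover have "finite G" by (simp add: G_def)
    ultimately show ?thesis using inj by (metis card_inj_on_le inj_on_finite)
  qed
  then show ?thesis using that[of "card G"] by blast
qed

text \<open>By \<open>near_not_subset\<close> separated bad points have different sets of almost
  shortest vectors, all of them subsets of one set of at most \<open>M\<close> vectors. The bound
  \<open>2 ^ M\<close> is fixed before \<open>\<delta>\<close> and \<open>\<eta>\<close>, so that
  the batch length, and with it \<open>\<delta>\<close>, can later be chosen in terms of
  \<open>n\<close>.\<close>

lemma card_separated_bad:
  assumes r: "0 < r" and b: "0 < b" "b \<le> 1"
  obtains n where "\<And>\<delta> \<eta>. 0 < \<delta> \<Longrightarrow> 0 < \<eta> \<Longrightarrow> \<exists>\<epsilon>>0. \<epsilon> \<le> r / 2 \<and>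
    (\<forall>\<Lambda> F. minima_bounded r \<Lambda> \<longrightarrow> (\<forall>u\<in>\<Lambda>. \<forall>v\<in>\<Lambda>. u - v \<in> \<Lambda>) \<longrightarrow> finite F \<longrightarrow>
      (\<forall>x\<in>F. \<bar>x\<bar> \<le> 1 \<and> (\<forall>v\<in>\<Lambda>. v \<noteq> 0 \<longrightarrow> \<bar>fst v + x * snd v\<bar> \<le> 2 * r * K \<longrightarrow> \<eta> \<le> \<bar>snd v\<bar>) \<and>
        (\<exists>y. b \<le> y \<and> y \<le> 1 \<and> admissible \<Lambda> (r - \<epsilon>) x y)) \<longrightarrow>
      (\<forall>x\<in>F. \<forall>x'\<in>F. x \<noteq> x' \<longrightarrow> \<delta> \<le> \<bar>x - x'\<bar>) \<longrightarrow> card F \<le> n)"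
proof -
  obtain M where M: "\<And>\<Lambda> x0 y0. \<lbrakk>\<And>u v. u \<in> \<Lambda> \<Longrightarrow> v \<in> \<Lambda> \<Longrightarrow> u - v \<in> \<Lambda>; \<bar>x0\<bar> \<le> 1; b \<le> y0; y0 \<le> 1;
      admissible \<Lambda> (r / 2) x0 y0\<rbrakk>
    \<Longrightarrow> finite (\<Union>x\<in>{-1..1}. \<Union>y\<in>{b..1}. near \<Lambda> (2 * r) x y) \<and>
      card (\<Union>x\<in>{-1..1}. \<Union>y\<in>{b..1}. near \<Lambda> (2 * r) x y) \<le> M"
    using card_near_vectors[OF r b] by blast
  show ?thesis
  proof (rule that[of "2 ^ M"])
    fix \<delta> \<eta> :: real assume \<delta>: "0 < \<delta>" and \<eta>: "0 < \<eta>"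
    obtain \<epsilon> \<sigma> where \<epsilon>: "0 < \<epsilon>" "\<epsilon> \<le> r / 2" and \<sigma>: "0 < \<sigma>" "\<sigma> \<le> r"
      and *: "\<And>\<Lambda> x y x' y'. \<lbrakk>minima_bounded r \<Lambda>; \<bar>x\<bar> \<le> 1; \<bar>x'\<bar> \<le> 1; b \<le> y; y \<le> 1; b \<le> y'; y' \<le> 1;
       \<delta> \<le> \<bar>x - x'\<bar>; admissible \<Lambda> (r - \<epsilon>) x y; \<forall>v \<in> near \<Lambda> (2 * r) x y. \<eta> \<le> \<bar>snd v\<bar>\<rbrakk>
      \<Longrightarrow> \<not> near \<Lambda> (r + \<sigma>) x y \<subseteq> near \<Lambda> (r + \<sigma>) x' y'"
      using near_not_subset[OF r b \<delta> \<eta>] by metis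
    have "card F \<le> 2 ^ M"
      if min: "minima_bounded r \<Lambda>" and sub: "\<forall>u\<in>\<Lambda>. \<forall>v\<in>\<Lambda>. u - v \<in> \<Lambda>" and fin: "finite F"
        and F: "\<forall>x\<in>F. \<bar>x\<bar> \<le> 1 \<and> (\<forall>v\<in>\<Lambda>. v \<noteq> 0 \<longrightarrow> \<bar>fst v + x * snd v\<bar> \<le> 2 * r * K \<longrightarrow> \<eta> \<le> \<bar>snd v\<bar>) \<and>
          (\<exists>y. b \<le> y \<and> y \<le> 1 \<and> admissible \<Lambda> (r - \<epsilon>) x y)"
        and sep: "\<forall>x\<in>F. \<forall>x'\<in>F. x \<noteq> x' \<longrightarrow> \<delta> \<le> \<bar>x - x'\<bar>" for \<Lambda> F
    proof (cases "F = {}")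
      case False
      obtain Y where Y: "\<And>x. x \<in> F \<Longrightarrow> b \<le> Y x \<and> Y x \<le> 1 \<and> admissible \<Lambda> (r - \<epsilon>) x (Y x)"
        using F by metis
      define V where "V = (\<Union>x\<in>{-1..1}. \<Union>y\<in>{b..1}. near \<Lambda> (2 * r) x y)"
      \<comment> \<open>Any element of \<open>F\<close> can be the base point for
        \<open>card_near_vectors\<close>, because \<open>\<epsilon> \<le> r / 2\<close>.\<close>
      obtain x0 where x0: "x0 \<in> F" using False by blast
      have "(r / 2) * sqrt (Y x0) \<le> (r - \<epsilon>) * sqrt (Y x0)"
        using \<epsilon> Y[OF x0] b by (intro mult_right_mono) auto
      then have "admissible \<Lambda> (r / 2) x0 (Y x0)"
        using Y[OF x0] by (auto simp: admissible_def intro: order_trans)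
      then have V: "finite V" "card V \<le> M"
        using M[of \<Lambda> x0 "Y x0"] sub F x0 Y[OF x0] unfolding V_def by blast+
      define f where "f x = near \<Lambda> (r + \<sigma>) x (Y x)" for x
      have "inj_on f F"
      proof (rule inj_onI, rule ccontr)
        fix x x' assume x: "x \<in> F" "x' \<in> F" "f x = f x'" "x \<noteq> x'"
        have "\<forall>v \<in> near \<Lambda> (2 * r) x (Y x). \<eta> \<le> \<bar>snd v\<bar>"
        proof
          fix v assume v: "v \<in> near \<Lambda> (2 * r) x (Y x)"
          then have "\<bar>fst v + x * snd v\<bar> \<le> 2 * r * K" using near_bounds[OF r b(1)] Y[OF x(1)] by blast
          then show "\<eta> \<le> \<bar>snd v\<bar>" using F x(1) v by (auto simp: near_def)
        qed
        then have "\<not> f x \<subseteq> f x'"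
          unfolding f_def using F sep x Y[OF x(1)] Y[OF x(2)] by (intro *[OF min]) auto
        then show False using x by simp
      qed
      moreover have "f ` F \<subseteq> Pow V"
      proof
        fix S assume "S \<in> f ` F"
        then obtain x where x: "x \<in> F" "S = f x" by blast
        have "(r + \<sigma>) * sqrt (Y x) \<le> (2 * r) * sqrt (Y x)"
          using \<sigma> Y[OF x(1)] b by (intro mult_right_mono) auto
        then have "f x \<subseteq> near \<Lambda> (2 * r) x (Y x)" by (auto simp: f_def near_def)
        moreover have "x \<in> {-1..1}" "Y x \<in> {b..1}" using F x Y[OF x(1)] by (auto simp: abs_le_iff)
        ultimately show "S \<in> Pow V" unfolding V_def x(2) by blast
      qed
      ultimately have "card F \<le> card (Pow V)" using V by (intro card_inj_on_le) auto
      also have "\<dots> = 2 ^ card V" using V by (simp add: card_Pow)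
      also have "\<dots> \<le> 2 ^ M" using V by (intro power_increasing) auto
      finally show ?thesis .
    qed simp
    then show "\<exists>\<epsilon>>0. \<epsilon> \<le> r / 2 \<and>
    (\<forall>\<Lambda> F. minima_bounded r \<Lambda> \<longrightarrow> (\<forall>u\<in>\<Lambda>. \<forall>v\<in>\<Lambda>. u - v \<in> \<Lambda>) \<longrightarrow> finite F \<longrightarrow>
      (\<forall>x\<in>F. \<bar>x\<bar> \<le> 1 \<and> (\<forall>v\<in>\<Lambda>. v \<noteq> 0 \<longrightarrow> \<bar>fst v + x * snd v\<bar> \<le> 2 * r * K \<longrightarrow> \<eta> \<le> \<bar>snd v\<bar>) \<and>
        (\<exists>y. b \<le> y \<and> y \<le> 1 \<and> admissible \<Lambda> (r - \<epsilon>) x y)) \<longrightarrow>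
      (\<forall>x\<in>F. \<forall>x'\<in>F. x \<noteq> x' \<longrightarrow> \<delta> \<le> \<bar>x - x'\<bar>) \<longrightarrow> card F \<le> 2 ^ M)"
      using \<epsilon> by blast
  qed
qed

end

section \<open>Dangerous points\<close>


text \<open>Different fractions are at least \<open>1 / (q * q')\<close> apart, which here is at
  least \<open>R\<close>; an interval of length \<open>2 * (R + d)\<close>, less than
  \<open>3 * R\<close>, holds at most three of them.\<close>

lemma card_rationals_near:
  fixes c R d :: real
  assumes R: "0 < R" and d: "0 \<le> d" "d \<le> R / 3"
  defines "S \<equiv> {real_of_int p / real_of_int q | p q. 0 < q \<and> R \<le> 1 / (real_of_int q)\<^sup>2 \<and>
    \<bar>real_of_int p / real_of_int q - c\<bar> \<le> R + d}"
  shows "finite S \<and> card S \<le> 3"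
proof -
  define f where "f x = \<lfloor>(x - (c - R - d)) / R\<rfloor>" for x
  have sep: "R \<le> \<bar>x - x'\<bar>" if x: "x \<in> S" "x' \<in> S" "x \<noteq> x'" for x x'
  proof -
    obtain p q p' q' where pq: "x = real_of_int p / real_of_int q" "0 < q" "R \<le> 1 / (real_of_int q)\<^sup>2"
      "x' = real_of_int p' / real_of_int q'" "0 < q'" "R \<le> 1 / (real_of_int q')\<^sup>2"
      using x unfolding S_def by blast
    have diff: "x - x' = real_of_int (p * q' - p' * q) / (real_of_int q * real_of_int q')"
      unfolding pq(1,4) using pq(2,5) by (simp add: field_simps)
    have "p * q' - p' * q \<noteq> 0"
    proof
      assume eq: "p * q' - p' * q = 0"
      show False using diff x(3) unfolding eq by simp
    qed
    then have "1 \<le> \<bar>real_of_int (p * q' - p' * q)\<bar>" by (metis of_int_abs of_int_1_le_iff int_one_le_iff_zero_less zero_less_abs_iff)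
    then have ge: "1 / (real_of_int q * real_of_int q') \<le> \<bar>x - x'\<bar>"
      unfolding diff using pq by (simp add: abs_mult divide_right_mono)
    have "sqrt R \<le> 1 / real_of_int q" "sqrt R \<le> 1 / real_of_int q'"
      using pq R by (auto intro!: real_le_lsqrt simp: power_divide)
    then have "sqrt R * sqrt R \<le> (1 / real_of_int q) * (1 / real_of_int q')"
      using R pq by (intro mult_mono) auto
    then show ?thesis using ge R by simp
  qed
  have "inj_on f S"
  proof (rule inj_onI, rule ccontr)
    fix x x' assume x: "x \<in> S" "x' \<in> S" "f x = f x'" "x \<noteq> x'"
    have "\<bar>(x - (c - R - d)) / R - (x' - (c - R - d)) / R\<bar> < 1"
      using x(3) unfolding f_def by linarith
    then have "\<bar>(x - x') / R\<bar> < 1" by (simp add: diff_divide_distrib[symmetric])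
    then show False using sep[OF x(1,2,4)] R by (simp add: abs_divide)
  qed
  moreover have "f ` S \<subseteq> {0..2}"
  proof
    fix k assume "k \<in> f ` S"
    then obtain x where x: "\<bar>x - c\<bar> \<le> R + d" "k = f x" by (auto simp: S_def)
    have "0 \<le> (x - (c - R - d)) / R" using x R by (intro divide_nonneg_pos) linarith+
    moreover have "(x - (c - R - d)) / R < 3" using x R d by (simp add: pos_divide_less_eq)
    ultimately show "k \<in> {0..2}" unfolding x(2) f_def by simp
  qed
  ultimately have "finite S \<and> card S \<le> card {0..2::int}"
    using inj_on_finite[of f S "{0..2}"] card_inj_on_le[of f S "{0..2}"] by simp
  then show ?thesis by simp
qed

text \<open>Yields the batch length: \<open>D\<close> turns produce at most \<open>n\<close>
  dangerous centres each, and three rationals are added per batch.\<close>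

lemma linear_less_exponential: "\<exists>D>0. D * n + 3 < 2 ^ (D::nat)"
proof -
  \<comment> \<open>The constant 8 in place of 3 lets the induction step go through.\<close>
  have "n\<^sup>2 + 5 * n + 8 < 2 ^ (n + 5)"
  proof (induction n)
    case (Suc n)
    have "(Suc n)\<^sup>2 + 5 * Suc n + 8 \<le> 2 * (n\<^sup>2 + 5 * n + 8)" by (simp add: power2_eq_square)
    also have "\<dots> < 2 * 2 ^ (n + 5)" using Suc by simp
    finally show ?case by (simp only: add_Suc power_Suc)
  qed simp
  then have "(n + 5) * n + 3 < 2 ^ (n + 5)" by (simp add: power2_eq_square algebra_simps)
  then show ?thesis by (intro exI[of _ "n + 5"]) auto
qed

text \<open>The point is the supremum of the left endpoints. The second property is for plays whose
  radii stay above some \<open>e\<close>: there the intersection contains an interval, hence a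
  rational.\<close>

lemma nested_play_common_point:
  assumes \<beta>: "0 < \<beta>" "\<beta> < 1 / 3" and play: "nested_play \<beta> B"
  obtains x where "x \<in> (\<Inter>n. ivl (B n))"
    "\<And>e z. \<lbrakk>0 < e; \<forall>n. e \<le> snd (B n); x \<le> z; z \<le> x + e\<rbrakk> \<Longrightarrow> z \<in> (\<Inter>n. ivl (B n))"
proof -
  define l where "l n = fst (B n) - snd (B n)" for n
  define u where "u n = fst (B n) + snd (B n)" for n
  have ivl: "ivl (B n) = {l n..u n}" for n by (auto simp: ivl_def l_def u_def dist_real_def)
  have mono: "l m \<le> l n \<and> u n \<le> u m" if "m \<le> n" for m n
    using nested_play_subset[OF \<beta> play that] nested_play_radius_pos[OF \<beta> play, of n] unfolding ivl
    by (auto simp: l_def u_def)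
  have gap: "l n + 2 * e \<le> u m" if "\<forall>n. e \<le> snd (B n)" for n m e
  proof -
    have "l (max m n) + 2 * e \<le> u (max m n)" using that by (simp add: l_def u_def)
    then show ?thesis using mono[of n "max m n"] mono[of m "max m n"] by simp
  qed
  have nonneg: "\<forall>n. 0 \<le> snd (B n)" using nested_play_radius_pos[OF \<beta> play] less_imp_le by blast
  have lu: "l n \<le> u m" for n m
    using gap[OF nonneg, of n m] by simp
  define x where "x = (SUP n. l n)"
  have bdd: "bdd_above (range l)" using lu by (auto simp: bdd_above_def)
  have lx: "l n \<le> x" for n unfolding x_def by (rule cSUP_upper[OF _ bdd]) simp
  have xu: "x + 2 * e \<le> u m" if "\<forall>n. e \<le> snd (B n)" for m e
  proof -
    have "x \<le> u m - 2 * e" unfolding x_def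
      by (rule cSUP_least) (use gap[OF that, of _ m] in \<open>auto simp: algebra_simps\<close>)
    then show ?thesis by simp
  qed
  show ?thesis
  proof (rule that[of x])
    show "x \<in> (\<Inter>n. ivl (B n))" using lx xu[OF nonneg] by (auto simp: ivl)
    fix e z assume "0 < e" and e: "\<forall>n. e \<le> snd (B n)" and z: "x \<le> z" "z \<le> x + e"
    have "l n \<le> z \<and> z \<le> u n" for n using lx[of n] xu[OF e, of n] z \<open>0 < e\<close> by linarith
    then show "z \<in> (\<Inter>n. ivl (B n))" by (auto simp: ivl)
  qed
qed

lemma irrational_separated:
  assumes "\<alpha> \<notin> \<rat>" "finite I" "0 \<notin> I"
  shows "\<exists>\<theta>>0. \<forall>q\<in>I. \<forall>p. \<theta> \<le> \<bar>real_of_int q * \<alpha> - real_of_int p\<bar>"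
  using assms(2,3)
proof (induction I rule: finite_induct)
  case empty
  then show ?case by (auto intro: exI[of _ 1])
next
  case (insert q I)
  then obtain \<theta> where \<theta>: "0 < \<theta>" "\<forall>q\<in>I. \<forall>p. \<theta> \<le> \<bar>real_of_int q * \<alpha> - real_of_int p\<bar>" by auto
  define d where "d = \<bar>real_of_int q * \<alpha> - real_of_int (round (real_of_int q * \<alpha>))\<bar>"
  have "d \<noteq> 0"
  proof
    assume "d = 0"
    then have "\<alpha> = real_of_int (round (real_of_int q * \<alpha>)) / real_of_int q"
      using insert.prems by (simp add: d_def field_simps)
    then show False using assms(1) by (metis Rats_divide Rats_of_int)
  qed
  then have "0 < d" by (simp add: d_def)
  moreover have "d \<le> \<bar>real_of_int q * \<alpha> - real_of_int p\<bar>" for p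
    unfolding d_def by (rule round_diff_minimal)
  ultimately show ?case using \<theta> by (intro exI[of _ "min \<theta> d"]) (auto simp: min_le_iff_disj)
qed

section \<open>Bad points of the integer lattice and Alice's strategy\<close>

context plane_norm
begin

text \<open>This is \<open>admissible\<close> for the integer lattice, with \<open>-p\<close> as
  first coordinate to match \<open>Lambda\<close>.\<close>

definition bad :: "real \<Rightarrow> real \<Rightarrow> real \<Rightarrow> bool" where
  "bad s x y \<longleftrightarrow> (\<forall>p q :: int. (p, q) \<noteq> (0, 0) \<longrightarrow>
     s * sqrt y \<le> N (real_of_int q * x - real_of_int p) (real_of_int q * y))"

text \<open>The condition on lattice vectors in \<open>card_separated_bad\<close>, rescaled to a
  window of size \<open>R\<close>. It fails when a rational of too small a denominator lies close to
  \<open>x\<close>, that is, when some short vector is almost horizontal.\<close>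

definition steep :: "real \<Rightarrow> real \<Rightarrow> real \<Rightarrow> real \<Rightarrow> bool" where
  "steep C \<eta> R x \<longleftrightarrow> (\<forall>p q :: int. (p, q) \<noteq> (0, 0) \<longrightarrow>
     \<bar>real_of_int q * x - real_of_int p\<bar> \<le> C * sqrt R \<longrightarrow> \<eta> \<le> \<bar>real_of_int q\<bar> * sqrt R)"

text \<open>The map to \<open>((x - c) / R, y / R)\<close> carries the window to the fixed box of
  \<open>card_separated_bad\<close> and the integer lattice to another lattice. Since that lemma is
  uniform in the lattice, \<open>n\<close> depends on neither \<open>c\<close> nor
  \<open>R\<close>.\<close>

lemma slab_cover:
  assumes r: "0 < r" and b: "0 < b" "b \<le> 1"
    and bound: "\<forall>x y s. 0 < y \<longrightarrow> bad s x y \<longrightarrow> s \<le> r"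
  obtains n where "\<And>\<delta> \<eta>. 0 < \<delta> \<Longrightarrow> 0 < \<eta> \<Longrightarrow> \<exists>\<epsilon>>0. \<epsilon> \<le> r / 2 \<and> (\<forall>c R. 0 < R \<longrightarrow>
    (\<exists>C. finite C \<and> card C \<le> n \<and>
      {x. \<bar>x - c\<bar> \<le> R \<and> steep (2 * r * K) \<eta> R x \<and> (\<exists>y. b * R \<le> y \<and> y \<le> R \<and> bad (r - \<epsilon>) x y)}
        \<subseteq> (\<Union>P\<in>C. cball P (\<delta> * R))))"
proof -
  obtain n where n: "\<And>\<delta> \<eta>. 0 < \<delta> \<Longrightarrow> 0 < \<eta> \<Longrightarrow> \<exists>\<epsilon>>0. \<epsilon> \<le> r / 2 \<and>
    (\<forall>\<Lambda> F. minima_bounded r \<Lambda> \<longrightarrow> (\<forall>u\<in>\<Lambda>. \<forall>v\<in>\<Lambda>. u - v \<in> \<Lambda>) \<longrightarrow> finite F \<longrightarrow>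
      (\<forall>x\<in>F. \<bar>x\<bar> \<le> 1 \<and> (\<forall>v\<in>\<Lambda>. v \<noteq> 0 \<longrightarrow> \<bar>fst v + x * snd v\<bar> \<le> 2 * r * K \<longrightarrow> \<eta> \<le> \<bar>snd v\<bar>) \<and>
        (\<exists>y. b \<le> y \<and> y \<le> 1 \<and> admissible \<Lambda> (r - \<epsilon>) x y)) \<longrightarrow>
      (\<forall>x\<in>F. \<forall>x'\<in>F. x \<noteq> x' \<longrightarrow> \<delta> \<le> \<bar>x - x'\<bar>) \<longrightarrow> card F \<le> n)"
    using card_separated_bad[OF r b] by blast
  show ?thesis
  proof (rule that[of n])
    fix \<delta> \<eta> :: real assume \<delta>: "0 < \<delta>" and \<eta>: "0 < \<eta>"
    obtain \<epsilon> where \<epsilon>: "0 < \<epsilon>" "\<epsilon> \<le> r / 2" and card: "\<And>\<Lambda> F. \<lbrakk>minima_bounded r \<Lambda>; \<forall>u\<in>\<Lambda>. \<forall>v\<in>\<Lambda>. u - v \<in> \<Lambda>; finite F;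
      \<forall>x\<in>F. \<bar>x\<bar> \<le> 1 \<and> (\<forall>v\<in>\<Lambda>. v \<noteq> 0 \<longrightarrow> \<bar>fst v + x * snd v\<bar> \<le> 2 * r * K \<longrightarrow> \<eta> \<le> \<bar>snd v\<bar>) \<and>
        (\<exists>y. b \<le> y \<and> y \<le> 1 \<and> admissible \<Lambda> (r - \<epsilon>) x y);
      \<forall>x\<in>F. \<forall>x'\<in>F. x \<noteq> x' \<longrightarrow> \<delta> \<le> \<bar>x - x'\<bar>\<rbrakk> \<Longrightarrow> card F \<le> n"
      using n[OF \<delta> \<eta>] by blast
    have "\<exists>C. finite C \<and> card C \<le> n \<and> X \<subseteq> (\<Union>P\<in>C. cball P (\<delta> * R))"
      if R: "0 < R"
        and X: "X = {x. \<bar>x - c\<bar> \<le> R \<and> steep (2 * r * K) \<eta> R x \<and> (\<exists>y. b * R \<le> y \<and> y \<le> R \<and> bad (r - \<epsilon>) x y)}"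
      for c R X
    proof (rule maximal_separated_cover)
      show "0 \<le> \<delta> * R" using \<delta> R by simp
      fix F assume fin: "finite F" and FX: "F \<subseteq> X"
        and sep: "\<forall>x\<in>F. \<forall>x'\<in>F. x \<noteq> x' \<longrightarrow> \<delta> * R \<le> \<bar>x - x'\<bar>"
      define w where "w = sqrt R"
      have w: "0 < w" "w * w = R" using R by (auto simp: w_def)
      \<comment> \<open>The map from \<open>(p, q)\<close> to \<open>vec p q\<close> has determinant
        of absolute value 1; \<open>c\<close> and \<open>R\<close> are absorbed into the
        lattice.\<close>
      define vec where "vec p q = ((real_of_int q * c - real_of_int p) / w, real_of_int q * w)" for p q :: int
      define \<Lambda> where "\<Lambda> = {vec p q | p q. True}"
      have vec0: "vec p q \<noteq> 0 \<longleftrightarrow> (p, q) \<noteq> (0, 0)" for p q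
        using w by (auto simp: vec_def zero_prod_def)
      have fst_eq: "fst (vec p q) + (x - c) / R * snd (vec p q) = (real_of_int q * x - real_of_int p) / w" for x p q
        unfolding w(2)[symmetric] using w(1) by (simp add: vec_def field_simps)
      have point_eq: "at_point ((x - c) / R) (y / R) (vec p q)
          = N (real_of_int q * x - real_of_int p) (real_of_int q * y) / w" for x y p q
      proof -
        have "y / R * snd (vec p q) = (real_of_int q * y) / w"
          unfolding w(2)[symmetric] using w(1) by (simp add: vec_def field_simps)
        then show ?thesis unfolding at_point_def fst_eq
          using N_scale[of "1 / w" "real_of_int q * x - real_of_int p" "real_of_int q * y"] w by simp
      qed
      have adm: "admissible \<Lambda> s ((x - c) / R) (y / R) \<longleftrightarrow> bad s x y" for s x y
      proof -
        have "s * sqrt (y / R) \<le> at_point ((x - c) / R) (y / R) (vec p q) \<longleftrightarrow>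
            s * sqrt y \<le> N (real_of_int q * x - real_of_int p) (real_of_int q * y)" for p q
          unfolding point_eq using w by (simp add: real_sqrt_divide w_def[symmetric] divide_le_cancel)
        moreover have "admissible \<Lambda> s ((x - c) / R) (y / R) \<longleftrightarrow>
            (\<forall>p q. vec p q \<noteq> 0 \<longrightarrow> s * sqrt (y / R) \<le> at_point ((x - c) / R) (y / R) (vec p q))"
          unfolding admissible_def \<Lambda>_def by blast
        ultimately show ?thesis unfolding bad_def vec0 by simp
      qed
      have "minima_bounded r \<Lambda>"
        unfolding minima_bounded_def
      proof (intro allI impI)
        fix x y s :: real assume y: "0 < y" and "admissible \<Lambda> s x y"
        then have "bad s (x * R + c) (y * R)" using adm[of s "x * R + c" "y * R"] R by simp
        then show "s \<le> r" using bound y R by (meson mult_pos_pos)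
      qed
      moreover have "\<forall>u\<in>\<Lambda>. \<forall>v\<in>\<Lambda>. u - v \<in> \<Lambda>"
      proof (intro ballI)
        fix u v assume "u \<in> \<Lambda>" "v \<in> \<Lambda>"
        then obtain p q p' q' where "u = vec p q" "v = vec p' q'" by (auto simp: \<Lambda>_def)
        then have "u - v = vec (p - p') (q - q')" using w(1) by (simp add: vec_def diff_divide_distrib[symmetric] algebra_simps)
        then show "u - v \<in> \<Lambda>" by (auto simp: \<Lambda>_def)
      qed
      moreover define g where "g x = (x - c) / R" for x
      moreover have "\<forall>x\<in>g ` F. \<bar>x\<bar> \<le> 1 \<and> (\<forall>v\<in>\<Lambda>. v \<noteq> 0 \<longrightarrow> \<bar>fst v + x * snd v\<bar> \<le> 2 * r * K \<longrightarrow> \<eta> \<le> \<bar>snd v\<bar>) \<and>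
        (\<exists>y. b \<le> y \<and> y \<le> 1 \<and> admissible \<Lambda> (r - \<epsilon>) x y)"
      proof (rule ballI, elim imageE, intro conjI ballI impI)
        fix z x assume z: "z = g x" and "x \<in> F"
        then have x: "\<bar>x - c\<bar> \<le> R" "steep (2 * r * K) \<eta> R x" "\<exists>y. b * R \<le> y \<and> y \<le> R \<and> bad (r - \<epsilon>) x y"
          using FX X by auto
        show "\<bar>z\<bar> \<le> 1" using x(1) R by (simp add: z g_def abs_divide)
        obtain y where y: "b * R \<le> y" "y \<le> R" "bad (r - \<epsilon>) x y" using x(3) by blast
        show "\<exists>y. b \<le> y \<and> y \<le> 1 \<and> admissible \<Lambda> (r - \<epsilon>) z y"
          using y R adm by (intro exI[of _ "y / R"]) (auto simp: z g_def pos_le_divide_eq)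
        fix v assume v: "v \<in> \<Lambda>" "v \<noteq> 0" "\<bar>fst v + z * snd v\<bar> \<le> 2 * r * K"
        obtain p q where pq: "v = vec p q" using v by (auto simp: \<Lambda>_def)
        then have "\<bar>real_of_int q * x - real_of_int p\<bar> \<le> 2 * r * K * sqrt R"
          using v(3) w fst_eq unfolding z g_def by (simp add: abs_divide w_def[symmetric] pos_divide_le_eq)
        then have "\<eta> \<le> \<bar>real_of_int q\<bar> * sqrt R" using x(2) v(2) vec0 pq unfolding steep_def by blast
        then show "\<eta> \<le> \<bar>snd v\<bar>" using w by (simp add: pq vec_def abs_mult w_def[symmetric])
      qed
      moreover have "\<forall>x\<in>g ` F. \<forall>x'\<in>g ` F. x \<noteq> x' \<longrightarrow> \<delta> \<le> \<bar>x - x'\<bar>"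
      proof (intro ballI impI, elim imageE)
        fix z z' x x' assume z: "z \<noteq> z'" "z = g x" "z' = g x'" and x: "x \<in> F" "x' \<in> F"
        have "\<delta> * R \<le> \<bar>x - x'\<bar>" using sep x z by auto
        then have "\<delta> \<le> \<bar>(x - x') / R\<bar>" using R by (simp add: abs_divide pos_le_divide_eq)
        then show "\<delta> \<le> \<bar>z - z'\<bar>" by (simp add: z g_def diff_divide_distrib[symmetric])
      qed
      ultimately have "card (g ` F) \<le> n" using fin by (intro card) auto
      moreover have "inj_on g F" using R by (auto simp: g_def inj_on_def)
      ultimately show "card F \<le> n" by (simp add: card_image)
    qed
    then show "\<exists>\<epsilon>>0. \<epsilon> \<le> r / 2 \<and> (\<forall>c R. 0 < R \<longrightarrow>
      (\<exists>C. finite C \<and> card C \<le> n \<and>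
        {x. \<bar>x - c\<bar> \<le> R \<and> steep (2 * r * K) \<eta> R x \<and> (\<exists>y. b * R \<le> y \<and> y \<le> R \<and> bad (r - \<epsilon>) x y)}
          \<subseteq> (\<Union>P\<in>C. cball P (\<delta> * R))))"
      using \<epsilon> by blast
  qed
qed

text \<open>For large denominators, \<open>\<delta> / (real_of_int q)\<^sup>2\<close> is less than
  the distance from \<open>\<alpha>\<close> to the fraction, which is at most
  \<open>C * sqrt R / \<bar>q\<bar>\<close>; this bounds \<open>\<bar>q\<bar> * sqrt R\<close> from
  below. The finitely many small denominators are excluded by irrationality once \<open>R\<close> is
  small.\<close>

lemma steep_of_badly_approximable:
  assumes "\<alpha> \<notin> \<rat>" and C: "0 < C" and "0 < \<delta>" and R0: "0 < R0"
    and approx: "\<And>p q :: int. 0 < q \<Longrightarrow> 1 / (real_of_int q)\<^sup>2 < R0 \<Longrightarrow>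
      \<delta> / (real_of_int q)\<^sup>2 < \<bar>\<alpha> - real_of_int p / real_of_int q\<bar>"
  shows "\<exists>e>0. \<forall>R. 0 < R \<longrightarrow> R < e \<longrightarrow> steep C (\<delta> / C) R \<alpha>"
proof -
  define I where "I = {q :: int. q \<noteq> 0 \<and> R0 \<le> 1 / (real_of_int q)\<^sup>2}"
  have "I \<subseteq> {-\<lceil>1 / R0\<rceil>..\<lceil>1 / R0\<rceil>}"
  proof
    fix q assume q: "q \<in> I"
    moreover have "0 < (real_of_int q)\<^sup>2" using q by (simp add: I_def)
    ultimately have "R0 * (real_of_int q)\<^sup>2 \<le> 1" by (simp only: I_def mem_Collect_eq pos_le_divide_eq)
    then have "(real_of_int q)\<^sup>2 \<le> 1 / R0" using R0 by (simp add: pos_le_divide_eq mult.commute)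
    moreover have "\<bar>real_of_int q\<bar> \<le> (real_of_int q)\<^sup>2"
    proof -
      have "q \<noteq> 0" using q by (simp add: I_def)
      then have "1 \<le> \<bar>q\<bar>" by linarith
      then have "1 \<le> \<bar>real_of_int q\<bar>" by linarith
      then have "\<bar>real_of_int q\<bar> * 1 \<le> \<bar>real_of_int q\<bar> * \<bar>real_of_int q\<bar>" by (intro mult_left_mono) auto
      then show ?thesis by (simp add: power2_eq_square)
    qed
    ultimately show "q \<in> {-\<lceil>1 / R0\<rceil>..\<lceil>1 / R0\<rceil>}" by simp linarith
  qed
  then have "finite I" by (rule finite_subset) simp
  then obtain \<theta> where \<theta>: "0 < \<theta>" "\<And>q p. q \<in> I \<Longrightarrow> \<theta> \<le> \<bar>real_of_int q * \<alpha> - real_of_int p\<bar>"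
    using irrational_separated[OF assms(1), of I] by (auto simp: I_def)
  \<comment> \<open>Below this value \<open>C * sqrt R\<close> is less than 1, which excludes
    \<open>q = 0\<close>, and less than \<open>\<theta>\<close>, which excludes
    \<open>q \<in> I\<close>.\<close>
  define e where "e = (min 1 \<theta> / C)\<^sup>2"
  have "steep C (\<delta> / C) R \<alpha>" if R: "0 < R" "R < e" for R
    unfolding steep_def
  proof (intro allI impI)
    fix p q :: int assume pq: "(p, q) \<noteq> (0, 0)" and le: "\<bar>real_of_int q * \<alpha> - real_of_int p\<bar> \<le> C * sqrt R"
    have "sqrt R < sqrt e" using R by simp
    also have "\<dots> = min 1 \<theta> / C" using \<theta> C by (simp add: e_def)
    finally have small: "C * sqrt R < min 1 \<theta>" using C by (simp add: pos_less_divide_eq mult.commute)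
    have "q \<noteq> 0"
    proof
      assume "q = 0"
      then have "1 \<le> \<bar>real_of_int p\<bar>" using pq by (simp add: of_int_abs[symmetric] del: of_int_abs)
      then show False using le small \<open>q = 0\<close> by simp
    qed
    moreover have "q \<notin> I" using \<theta>(2)[of q p] le small by linarith
    ultimately have q: "q \<noteq> 0" "1 / (real_of_int q)\<^sup>2 < R0" by (auto simp: I_def)
    define t where "t = \<bar>real_of_int q\<bar>"
    have t: "0 < t" using q by (simp add: t_def)
    \<comment> \<open>Since \<open>approx\<close> is about positive denominators, a negative
      \<open>q\<close> changes sign together with \<open>p\<close>.\<close>
    have "\<delta> / t\<^sup>2 < \<bar>\<alpha> - real_of_int p / real_of_int q\<bar>"
      using approx[of "\<bar>q\<bar>" "sgn q * p"] q by (cases "0 < q") (auto simp: t_def sgn_if)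
    also have "\<bar>\<alpha> - real_of_int p / real_of_int q\<bar> = \<bar>real_of_int q * \<alpha> - real_of_int p\<bar> / t"
    proof -
      have "real_of_int q * \<alpha> - real_of_int p = real_of_int q * (\<alpha> - real_of_int p / real_of_int q)"
        using q by (simp add: right_diff_distrib)
      then show ?thesis using q(1) by (simp add: abs_mult t_def)
    qed
    also have "\<dots> \<le> C * sqrt R / t" using le t by (simp add: divide_right_mono)
    finally have "\<delta> < C * sqrt R * t" using t by (simp add: power2_eq_square field_simps)
    then show "\<delta> / C \<le> \<bar>real_of_int q\<bar> * sqrt R"
      using C by (simp add: t_def pos_divide_le_eq algebra_simps)
  qed
  moreover have "0 < e" using \<theta> C by (simp add: e_def)
  ultimately show ?thesis by blast
qed

text \<open>Bob's radii serve as the scale: turn \<open>k\<close> accounts for the heights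
  \<open>y\<close> between \<open>snd (B (Suc k))\<close> and \<open>snd (B k)\<close>, and each
  batch for the rationals with \<open>1 / (real_of_int q)\<^sup>2\<close> between its first and last
  radius. Avoiding these rationals makes the outcome steep at small scales, and avoiding the slabs
  then excludes bad heights.\<close>

lemma alice_wins:
  fixes S :: "real set"
  assumes r: "0 < r" and bound: "\<forall>x y s. 0 < y \<longrightarrow> bad s x y \<longrightarrow> s \<le> r"
    and rational: "\<rat> \<subseteq> S"
    and good: "\<And>\<alpha> \<epsilon> y0. \<lbrakk>0 < \<epsilon>; \<epsilon> \<le> r / 2; 0 < y0; \<And>y. 0 < y \<Longrightarrow> y \<le> y0 \<Longrightarrow> \<not> bad (r - \<epsilon>) \<alpha> y\<rbrakk> \<Longrightarrow> \<alpha> \<in> S"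
  shows "absolute_winning S"
  unfolding absolute_winning_def
proof (intro allI impI, elim conjE)
  fix \<beta> :: real assume \<beta>: "0 < \<beta>" "\<beta> < 1 / 3"
  have \<beta>1: "\<beta> \<le> 1" using \<beta> by simp
  obtain n where n: "\<And>\<delta> \<eta>. 0 < \<delta> \<Longrightarrow> 0 < \<eta> \<Longrightarrow> \<exists>\<epsilon>>0. \<epsilon> \<le> r / 2 \<and> (\<forall>c R. 0 < R \<longrightarrow>
    (\<exists>C. finite C \<and> card C \<le> n \<and>
      {x. \<bar>x - c\<bar> \<le> R \<and> steep (2 * r * K) \<eta> R x \<and> (\<exists>y. \<beta> * R \<le> y \<and> y \<le> R \<and> bad (r - \<epsilon>) x y)}
        \<subseteq> (\<Union>P\<in>C. cball P (\<delta> * R))))"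
    using slab_cover[OF r \<beta>(1) \<beta>1 bound] by blast
  obtain D :: nat where D: "0 < D" "D * n + 3 < 2 ^ D" using linear_less_exponential by blast
  \<comment> \<open>Dangerous intervals found at turn \<open>k\<close> have radius
    \<open>\<delta> * snd (B k)\<close>. At most \<open>D\<close> turns later Bob's radius is still
    at least \<open>\<beta> ^ D * snd (B k)\<close>, so they fit the radius
    \<open>\<beta> ^ Suc D\<close> times the current one that \<open>alice_avoids_batches\<close>
    asks for.\<close>
  define \<delta> where "\<delta> = \<beta> ^ Suc D * \<beta> ^ D"
  have \<delta>: "0 < \<delta>" using \<beta> by (simp add: \<delta>_def)
  define C0 where "C0 = 2 * r * K"
  have C0: "0 < C0" using r K_pos by (simp add: C0_def)
  \<comment> \<open>The steepness that \<open>steep_of_badly_approximable\<close> delivers from the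
    constant \<open>\<delta>\<close>.\<close>
  define \<eta> where "\<eta> = \<delta> / C0"
  have \<eta>: "0 < \<eta>" using \<delta> C0 by (simp add: \<eta>_def)
  obtain \<epsilon> where \<epsilon>: "0 < \<epsilon>" "\<epsilon> \<le> r / 2" and cover: "\<And>c R. 0 < R \<Longrightarrow> \<exists>C. finite C \<and> card C \<le> n \<and>
      {x. \<bar>x - c\<bar> \<le> R \<and> steep C0 \<eta> R x \<and> (\<exists>y. \<beta> * R \<le> y \<and> y \<le> R \<and> bad (r - \<epsilon>) x y)}
        \<subseteq> (\<Union>P\<in>C. cball P (\<delta> * R))"
    using n[OF \<delta> \<eta>] unfolding C0_def by blast
  define slab where "slab R R' = {x. steep C0 \<eta> R x \<and> (\<exists>y. R' \<le> y \<and> y \<le> R \<and> bad (r - \<epsilon>) x y)}" for R R'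
  define rats where "rats R R' = {x. \<exists>p q :: int. 0 < q \<and> R' \<le> 1 / (real_of_int q)\<^sup>2 \<and> 1 / (real_of_int q)\<^sup>2 \<le> R \<and>
      \<bar>x - real_of_int p / real_of_int q\<bar> \<le> \<beta> ^ Suc D * R'}" for R R'
  \<comment> \<open>The dangerous points gathered in the last \<open>D\<close> turns; before the
    first \<open>D\<close> turns are complete there are none.\<close>
  define Bad where "Bad h = (if length h \<le> D then {} else
      (\<Union>k\<in>{length h - 1 - D..<length h - 1}. slab (snd (h ! k)) (snd (h ! Suc k)))
        \<union> rats (snd (h ! (length h - 1 - D))) (snd (last h)))" for h :: "interval list"
  have Bad_eq: "Bad (map B [0..<Suc (Suc i * D)]) =
      (\<Union>k\<in>{i * D..<Suc i * D}. slab (snd (B k)) (snd (B (Suc k)))) \<union> rats (snd (B (i * D))) (snd (B (Suc i * D)))"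
    for B i
  proof -
    define M where "M = Suc i * D"
    define h where "h = map B [0..<Suc M]"
    have MD: "M - D = i * D" by (simp add: M_def)
    have "D \<le> M" by (simp add: M_def)
    then have len: "length h - 1 = M" "\<not> length h \<le> D" by (simp_all add: h_def)
    have last: "last h = B M" by (simp add: h_def)
    have nth: "h ! k = B k" if "k \<le> M" for k
      using that by (simp add: h_def del: upt_Suc)
    have "(\<Union>k\<in>{M - D..<M}. slab (snd (h ! k)) (snd (h ! Suc k))) = (\<Union>k\<in>{M - D..<M}. slab (snd (B k)) (snd (B (Suc k))))"
      by (intro SUP_cong refl arg_cong2[of _ _ _ _ slab] arg_cong[of _ _ snd] nth) auto
    then have "Bad h = (\<Union>k\<in>{M - D..<M}. slab (snd (B k)) (snd (B (Suc k)))) \<union> rats (snd (B (M - D))) (snd (B M))"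
      unfolding Bad_def len(1) last using len(2) nth[of "M - D"] by simp
    then show ?thesis unfolding MD unfolding h_def M_def .
  qed
  have coverable: "\<exists>C. finite C \<and> card C < 2 ^ D \<and>
      Bad (map B [0..<Suc (i * D)]) \<inter> ivl (B (i * D)) \<subseteq> (\<Union>P\<in>C. cball P (\<beta> ^ Suc D * snd (B (i * D))))"
    if play: "nested_play \<beta> B" for B i
  proof (cases i)
    case 0
    then show ?thesis using D by (intro exI[of _ "{}"]) (simp add: Bad_def)
  next
    case (Suc j)
    define R where "R = snd (B (i * D))"
    define c where "c = fst (B (i * D))"
    define d where "d = \<beta> ^ Suc D * R"
    note pos = nested_play_radius_pos[OF \<beta> play]
    have R: "0 < R" unfolding R_def by (rule pos)
    have ivl: "ivl (B (i * D)) = {x. \<bar>x - c\<bar> \<le> R}"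
      by (auto simp: ivl_def R_def c_def dist_real_def)
    have "\<beta> ^ D \<le> 1" using \<beta> by (intro power_le_one) auto
    then have "\<beta> ^ Suc D \<le> 1 / 3" using \<beta> mult_mono[of \<beta> "1 / 3" "\<beta> ^ D" 1] by simp
    then have d: "0 \<le> d" "d \<le> R / 3" using \<beta> R mult_right_mono[of "\<beta> ^ Suc D" "1 / 3" R] unfolding d_def by auto
    \<comment> \<open>Contains the part of the slab of turn \<open>k\<close> inside the current
      interval, because Bob's radius shrinks at most by the factor \<open>\<beta>\<close> per turn;
      its height range is that of \<open>cover\<close>.\<close>
    define X where "X k = {x. \<bar>x - c\<bar> \<le> snd (B k) \<and> steep C0 \<eta> (snd (B k)) x \<and>
      (\<exists>y. \<beta> * snd (B k) \<le> y \<and> y \<le> snd (B k) \<and> bad (r - \<epsilon>) x y)}" for k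
    have "\<exists>C. finite C \<and> card C \<le> n \<and> X k \<subseteq> (\<Union>P\<in>C. cball P (\<delta> * snd (B k)))" for k
      unfolding X_def by (rule cover[OF pos])
    then obtain Ck where Ck: "\<And>k. finite (Ck k)" "\<And>k. card (Ck k) \<le> n"
      "\<And>k. X k \<subseteq> (\<Union>P\<in>Ck k. cball P (\<delta> * snd (B k)))"
      by metis
    define J where "J = {j * D..<i * D}"
    define Q where "Q = {real_of_int p / real_of_int q | p q. 0 < q \<and> R \<le> 1 / (real_of_int q)\<^sup>2 \<and>
      \<bar>real_of_int p / real_of_int q - c\<bar> \<le> R + d}"
    have Q: "finite Q" "card Q \<le> 3" using card_rationals_near[OF R d, of c] unfolding Q_def by auto
    define C where "C = (\<Union>k\<in>J. Ck k) \<union> Q"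
    have "card (\<Union>k\<in>J. Ck k) \<le> (\<Sum>k\<in>J. card (Ck k))" by (rule card_UN_le) (simp add: J_def)
    also have "\<dots> \<le> (\<Sum>k\<in>J. n)" using Ck(2) by (intro sum_mono) auto
    also have "\<dots> = D * n" by (simp add: J_def Suc)
    finally have "card C \<le> D * n + 3" unfolding C_def using Q card_Un_le[of "\<Union>k\<in>J. Ck k" Q] by linarith
    then have "card C < 2 ^ D" using D by linarith
    moreover have "finite C" using Ck(1) Q by (simp add: C_def J_def)
    moreover have "x \<in> (\<Union>P\<in>C. cball P d)"
      if x: "x \<in> Bad (map B [0..<Suc (i * D)])" "\<bar>x - c\<bar> \<le> R" for x
    proof -
      consider (slab) k where "k \<in> J" "x \<in> slab (snd (B k)) (snd (B (Suc k)))"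
        | (rat) "x \<in> rats (snd (B (j * D))) R"
        using x(1) unfolding Suc Bad_eq J_def R_def by blast
      then show ?thesis
      proof cases
        case slab
        have kJ: "j * D \<le> k" "k < i * D" using slab(1) by (auto simp: J_def)
        have "R \<le> snd (B k)" unfolding R_def using nested_play_radius_mono[OF \<beta> play] kJ by simp
        moreover have "\<beta> * snd (B k) \<le> snd (B (Suc k))" using play by (simp add: nested_play_def)
        ultimately have "x \<in> X k"
          using slab(2) x(2) unfolding slab_def X_def by (auto intro: order_trans)
        then obtain P where P: "P \<in> Ck k" "x \<in> cball P (\<delta> * snd (B k))" using Ck(3) by blast
        have "\<delta> * snd (B k) = \<beta> ^ Suc D * (\<beta> ^ D * snd (B k))" by (simp add: \<delta>_def)
        also have "\<dots> \<le> d"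
        proof -
          define m where "m = i * D - k"
          have m: "m \<le> D" "i * D = k + m" using kJ by (auto simp: m_def Suc)
          have "\<beta> ^ D * snd (B k) \<le> \<beta> ^ m * snd (B k)"
            using m(1) \<beta> pos[of k] by (intro mult_right_mono power_decreasing) auto
          also have "\<dots> \<le> R" unfolding R_def m(2) by (rule nested_play_radius_ge[OF \<beta> play])
          finally show ?thesis unfolding d_def using \<beta> by (intro mult_left_mono) auto
        qed
        finally have "x \<in> cball P d" using P(2) by auto
        then show ?thesis using P(1) slab(1) by (auto simp: C_def)
      next
        case rat
        then obtain p q :: int where pq: "0 < q" "R \<le> 1 / (real_of_int q)\<^sup>2"
          "\<bar>x - real_of_int p / real_of_int q\<bar> \<le> d" unfolding rats_def d_def by blast
        have "\<bar>real_of_int p / real_of_int q - c\<bar> \<le> R + d" using pq(3) x(2) by linarith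
        then have "real_of_int p / real_of_int q \<in> Q" using pq unfolding Q_def by blast
        moreover have "x \<in> cball (real_of_int p / real_of_int q) d" using pq(3) by (simp add: dist_real_def abs_minus_commute)
        ultimately show ?thesis unfolding C_def by blast
      qed
    qed
    ultimately show ?thesis unfolding ivl R_def[symmetric] d_def[symmetric] by (intro exI[of _ C]) auto
  qed
  obtain \<sigma> where \<sigma>: "alice_strategy \<beta> \<sigma>" and avoid: "\<And>B i. bob_play \<beta> \<sigma> B \<Longrightarrow>
      ivl (B (Suc i * D)) \<inter> Bad (map B [0..<Suc (i * D)]) = {}"
    using alice_avoids_batches[OF \<beta> D(1), of Bad] coverable by blast
  have "(\<Inter>n. ivl (B n)) \<inter> S \<noteq> {}" if bob: "bob_play \<beta> \<sigma> B" for B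
  proof -
    note play = bob_play_nested[OF bob]
    note pos = nested_play_radius_pos[OF \<beta> play]
    note mono = nested_play_radius_mono[OF \<beta> play]
    obtain \<alpha> where \<alpha>: "\<alpha> \<in> (\<Inter>n. ivl (B n))"
      and fat: "\<And>e z. \<lbrakk>0 < e; \<forall>n. e \<le> snd (B n); \<alpha> \<le> z; z \<le> \<alpha> + e\<rbrakk> \<Longrightarrow> z \<in> (\<Inter>n. ivl (B n))"
      using nested_play_common_point[OF \<beta> play] by blast
    \<comment> \<open>Bob may keep the radii from shrinking to 0; the intersection then contains a
      rational, and rationals belong to \<open>S\<close>.\<close>
    consider (rational) "\<alpha> \<in> \<rat>" | (wide) e where "0 < e" "\<forall>n. e \<le> snd (B n)"
      | (main) "\<alpha> \<notin> \<rat>" "\<And>e. 0 < e \<Longrightarrow> \<exists>n. snd (B n) < e"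
      by (meson not_le)
    then show ?thesis
    proof cases
      case rational
      then show ?thesis using \<alpha> assms(3) by blast
    next
      case (wide e)
      obtain z where z: "z \<in> \<rat>" "\<alpha> < z" "z < \<alpha> + e" using Rats_dense_in_real[of \<alpha> "\<alpha> + e"] wide by auto
      then have "z \<in> (\<Inter>n. ivl (B n))" using fat[OF wide] by simp
      then show ?thesis using z assms(3) by blast
    next
      case main
      have notBad: "\<alpha> \<notin> slab (snd (B k)) (snd (B (Suc k)))" "\<alpha> \<notin> rats (snd (B (i * D))) (snd (B (Suc i * D)))"
        if "i * D \<le> k" "k < Suc i * D" for i k
      proof -
        \<comment> \<open>The points gathered up to turn \<open>Suc i * D\<close> are eliminated in
          the following \<open>D\<close> turns, hence the shift to \<open>Suc i\<close>.\<close>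
        have "\<alpha> \<notin> Bad (map B [0..<Suc (Suc i * D)])" using avoid[OF bob, of "Suc i"] \<alpha> by blast
        then show "\<alpha> \<notin> slab (snd (B k)) (snd (B (Suc k)))" "\<alpha> \<notin> rats (snd (B (i * D))) (snd (B (Suc i * D)))"
          unfolding Bad_eq using that by auto
      qed
      have "\<delta> / (real_of_int q)\<^sup>2 < \<bar>\<alpha> - real_of_int p / real_of_int q\<bar>"
        if q: "0 < q" "1 / (real_of_int q)\<^sup>2 < snd (B 0)" for p q :: int
      proof -
        define t where "t = 1 / (real_of_int q)\<^sup>2"
        have t: "0 < t" using q by (simp add: t_def)
        obtain m where m: "snd (B m) < t" using main(2)[OF t] by blast
        have "snd (B (m * D)) \<le> snd (B m)" using D by (intro mono) simp
        then have ex: "\<exists>i. snd (B (i * D)) \<le> t" using m by (intro exI[of _ m]) linarith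
        \<comment> \<open>The first batch boundary at which the radius has dropped to
          \<open>t\<close>; the batch before it is the one that accounts for the denominator
          \<open>q\<close>.\<close>
        define i where "i = (LEAST i. snd (B (i * D)) \<le> t)"
        have i: "snd (B (i * D)) \<le> t" unfolding i_def using ex by (rule LeastI_ex)
        have "i \<noteq> 0" using i q by (intro notI) (simp add: t_def)
        then obtain j where j: "i = Suc j" by (cases i) auto
        have jt: "t < snd (B (j * D))" using not_less_Least[of j "\<lambda>i. snd (B (i * D)) \<le> t"] j by (simp add: i_def)
        have "\<alpha> \<notin> rats (snd (B (j * D))) (snd (B (Suc j * D)))" using notBad(2)[of j "j * D"] D by simp
        moreover have "snd (B (Suc j * D)) \<le> 1 / (real_of_int q)\<^sup>2" "1 / (real_of_int q)\<^sup>2 \<le> snd (B (j * D))"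
          using i less_imp_le[OF jt] unfolding j t_def by blast+
        ultimately have "\<beta> ^ Suc D * snd (B (Suc j * D)) < \<bar>\<alpha> - real_of_int p / real_of_int q\<bar>"
          using q(1) unfolding rats_def mem_Collect_eq not_ex de_Morgan_conj by (meson not_le)
        moreover have "\<delta> * t \<le> \<beta> ^ Suc D * snd (B (Suc j * D))"
        proof -
          have "\<beta> ^ D * t \<le> \<beta> ^ D * snd (B (j * D))" using jt \<beta> by (intro mult_left_mono) auto
          also have "\<dots> \<le> snd (B (Suc j * D))" using nested_play_radius_ge[OF \<beta> play, of D "j * D"] by (simp add: add.commute)
          finally have "\<beta> ^ Suc D * (\<beta> ^ D * t) \<le> \<beta> ^ Suc D * snd (B (Suc j * D))" using \<beta> by (intro mult_left_mono) auto
          then show ?thesis by (simp add: \<delta>_def)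
        qed
        ultimately show ?thesis by (simp add: t_def)
      qed
      then obtain e where e: "0 < e" "\<And>R. 0 < R \<Longrightarrow> R < e \<Longrightarrow> steep C0 \<eta> R \<alpha>"
        using steep_of_badly_approximable[OF main(1) C0 \<delta> pos[of 0]] unfolding \<eta>_def by blast
      obtain n1 where n1: "snd (B n1) < e" using main(2)[OF e(1)] by blast
      have "\<alpha> \<in> S"
      proof (rule good[OF \<epsilon> pos[of n1]])
        fix y assume y: "0 < y" "y \<le> snd (B n1)"
        \<comment> \<open>The turn \<open>k\<close> preceding the first radius below
          \<open>y\<close> is the one whose slab contains the height \<open>y\<close>.\<close>
        define m where "m = (LEAST m. snd (B m) < y)"
        have m: "snd (B m) < y" unfolding m_def using main(2)[OF y(1)] by (rule LeastI_ex)
        have "n1 < m" using m y mono[of m n1] by (meson leI le_less_trans not_le order_trans)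
        then obtain k where k: "m = Suc k" "n1 \<le> k" by (cases m) auto
        have yk: "y \<le> snd (B k)" using not_less_Least[of k "\<lambda>m. snd (B m) < y"] k by (simp add: m_def)
        have st: "steep C0 \<eta> (snd (B k)) \<alpha>" using mono[OF k(2)] n1 pos[of k] by (intro e(2)) auto
        have "k div D * D \<le> k" "k < Suc (k div D) * D"
          using D(1) dividend_less_div_times[of D k] by (auto simp: add.commute)
        then have "\<alpha> \<notin> slab (snd (B k)) (snd (B (Suc k)))" by (rule notBad(1))
        then show "\<not> bad (r - \<epsilon>) \<alpha> y" using st yk m unfolding slab_def k(1) by auto
      qed
      then show ?thesis using \<alpha> by blast
    qed
  qed
  then show "\<exists>\<sigma>. alice_strategy \<beta> \<sigma> \<and> (\<forall>B. bob_play \<beta> \<sigma> B \<longrightarrow> (\<Inter>n. ivl (B n)) \<inter> S \<noteq> {})"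
    using \<sigma> by blast
qed

end

section \<open>From norms and lattices to the half-plane\<close>

definition norm2 :: "(real^2 \<Rightarrow> real) \<Rightarrow> real \<Rightarrow> real \<Rightarrow> real" where
  "norm2 \<nu> a b = \<nu> (vector [a, b])"

text \<open>Equivalence of norms in the plane: the given norm is Lipschitz for the Euclidean one, so
  it attains a minimum on the compact unit sphere, and definiteness makes this minimum
  positive.\<close>

lemma is_norm_plane_norm:
  assumes "is_norm \<nu>"
  shows "\<exists>K. plane_norm (norm2 \<nu>) K"
proof -
  have nonneg: "0 \<le> \<nu> x" and zero: "\<nu> x = 0 \<longleftrightarrow> x = 0" and scale: "\<nu> (a *\<^sub>R x) = \<bar>a\<bar> * \<nu> x"
    and tri: "\<nu> (x + y) \<le> \<nu> x + \<nu> y" for a x y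
    using assms by (auto simp: is_norm_def)
  define K1 where "K1 = \<nu> (vector [1, 0]) + \<nu> (vector [0, 1]) + 1"
  have K1: "1 \<le> K1" using nonneg by (simp add: K1_def)
  have upper: "\<nu> (vector [a, b]) \<le> K1 * (\<bar>a\<bar> + \<bar>b\<bar>)" for a b
  proof -
    have "vector [a, b] = a *\<^sub>R vector [1, 0] + b *\<^sub>R (vector [0, 1] :: real^2)"
      by (simp add: vec_eq_iff forall_2)
    then have "\<nu> (vector [a, b]) \<le> \<bar>a\<bar> * \<nu> (vector [1, 0]) + \<bar>b\<bar> * \<nu> (vector [0, 1])"
      using tri scale by metis
    also have "\<dots> \<le> \<bar>a\<bar> * K1 + \<bar>b\<bar> * K1"
      using nonneg by (intro add_mono mult_left_mono) (auto simp: K1_def)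
    finally show ?thesis by (simp add: algebra_simps)
  qed
  have upper': "\<nu> x \<le> 2 * K1 * norm x" for x
  proof -
    have "\<nu> x \<le> K1 * (\<bar>x $ 1\<bar> + \<bar>x $ 2\<bar>)"
    proof -
      have "vector [x $ 1, x $ 2] = x" by (simp add: vec_eq_iff forall_2)
      then show ?thesis using upper[of "x $ 1" "x $ 2"] by simp
    qed
    also have "\<dots> \<le> K1 * (norm x + norm x)"
      using K1 component_le_norm_cart[of x] by (intro mult_left_mono add_mono) auto
    finally show ?thesis by simp
  qed
  have lip: "\<bar>\<nu> x - \<nu> y\<bar> \<le> 2 * K1 * norm (x - y)" for x y
  proof -
    have "\<nu> x \<le> \<nu> (x - y) + \<nu> y" using tri[of "x - y" y] by simp
    moreover have "\<nu> y \<le> \<nu> (y - x) + \<nu> x" using tri[of "y - x" x] by simp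
    ultimately show ?thesis using upper'[of "x - y"] upper'[of "y - x"] by (simp add: norm_minus_commute)
  qed
  have "continuous_on (sphere 0 1) \<nu>"
  proof (rule continuous_onI)
    fix x e assume e: "0 < (e::real)"
    show "\<exists>d>0. \<forall>x'\<in>sphere 0 1. dist x' x < d \<longrightarrow> dist (\<nu> x') (\<nu> x) \<le> e"
    proof (intro exI[of _ "e / (2 * K1)"] conjI ballI impI)
      show "0 < e / (2 * K1)" using e K1 by simp
      fix x' assume "dist x' x < e / (2 * K1)"
      then have "2 * K1 * norm (x' - x) \<le> e" using K1 by (simp add: dist_norm field_simps)
      then show "dist (\<nu> x') (\<nu> x) \<le> e" using lip[of x' x] by (simp add: dist_real_def)
    qed
  qed
  moreover have "sphere (0::real^2) 1 \<noteq> {}" by simp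
  ultimately obtain x0 where x0: "x0 \<in> sphere 0 1" "\<And>x. x \<in> sphere 0 1 \<Longrightarrow> \<nu> x0 \<le> \<nu> x"
    using continuous_attains_inf[OF compact_sphere] by metis
  define m where "m = \<nu> x0"
  have "x0 \<noteq> 0" using x0(1) by auto
  then have m: "0 < m" using nonneg[of x0] zero[of x0] by (simp add: m_def)
  have lower: "m * norm x \<le> \<nu> x" for x
  proof (cases "x = 0")
    case False
    have "m \<le> \<nu> ((1 / norm x) *\<^sub>R x)" unfolding m_def using False by (intro x0(2)) simp
    then show ?thesis using False by (simp add: scale field_simps)
  qed (simp add: nonneg)
  define K where "K = max K1 (1 / m)"
  have comp: "\<bar>t\<bar> \<le> K * \<nu> x" if "\<bar>t\<bar> \<le> norm x" for t x
  proof -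
    have "norm x \<le> 1 / m * \<nu> x" using lower[of x] m by (simp add: field_simps)
    also have "\<dots> \<le> K * \<nu> x" using nonneg by (intro mult_right_mono) (auto simp: K_def)
    finally show ?thesis using that by simp
  qed
  have "plane_norm (norm2 \<nu>) K"
  proof
    show "1 \<le> K" using K1 by (simp add: K_def)
    fix a b a' b' t :: real
    have "K1 * (\<bar>a\<bar> + \<bar>b\<bar>) \<le> K * (\<bar>a\<bar> + \<bar>b\<bar>)" by (intro mult_right_mono) (auto simp: K_def)
    then show "norm2 \<nu> a b \<le> K * (\<bar>a\<bar> + \<bar>b\<bar>)" using upper[of a b] by (simp add: norm2_def)
    show "\<bar>a\<bar> \<le> K * norm2 \<nu> a b" unfolding norm2_def
      using component_le_norm_cart[of "vector [a, b] :: real^2" 1] by (intro comp) simp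
    show "\<bar>b\<bar> \<le> K * norm2 \<nu> a b" unfolding norm2_def
      using component_le_norm_cart[of "vector [a, b] :: real^2" 2] by (intro comp) simp
    have "vector [t * a, t * b] = t *\<^sub>R (vector [a, b] :: real^2)" by (simp add: vec_eq_iff forall_2)
    then show "norm2 \<nu> (t * a) (t * b) = \<bar>t\<bar> * norm2 \<nu> a b" by (simp add: norm2_def scale)
    have "vector [a + a', b + b'] = vector [a, b] + (vector [a', b'] :: real^2)" by (simp add: vec_eq_iff forall_2)
    then show "norm2 \<nu> (a + a') (b + b') \<le> norm2 \<nu> a b + norm2 \<nu> a' b'" by (simp add: norm2_def tri)
  qed
  then show ?thesis by blast
qed

lemma matrix_vector_mult_2:
  fixes z :: "real^2"
  shows "(vector [vector [a, b], vector [c, d]] :: real^2^2) *v z = vector [a * z $ 1 + b * z $ 2, c * z $ 1 + d * z $ 2]"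
  by (simp add: vec_eq_iff forall_2 matrix_vector_mult_def sum_2)

text \<open>The definition of the critical covolume, applied to the lattice spanned by the columns of
  \<open>[[-1, x], [0, y]]\<close> scaled by \<open>1 / (s * sqrt y)\<close>, which has covolume \<open>1 / s\<^sup>2\<close>.\<close>

lemma bad_le_critical:
  assumes norm: "is_norm \<nu>" and pn: "plane_norm (norm2 \<nu>) K" and \<Delta>: "0 < crit_covolume \<nu>"
    and y: "0 < y" and bad: "plane_norm.bad (norm2 \<nu>) s x y"
  shows "s \<le> 1 / sqrt (crit_covolume \<nu>)"
proof (cases "0 < s")
  case False
  moreover have "0 < 1 / sqrt (crit_covolume \<nu>)" using \<Delta> by simp
  ultimately show ?thesis by linarith
next
  case s: True
  interpret plane_norm "norm2 \<nu>" K by (rule pn)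
  define k where "k = 1 / (s * sqrt y)"
  have k: "0 < k" "k * (s * sqrt y) = 1" using s y by (auto simp: k_def)
  define g :: "real^2^2" where "g = vector [vector [-k, k * x], vector [0, k * y]]"
  have "det g = -(k * k * y)" by (simp add: g_def det_2)
  also have "k * k * y = 1 / s\<^sup>2"
  proof -
    have "(s * sqrt y) * (s * sqrt y) = s\<^sup>2 * y" using y by (simp add: power2_eq_square)
    then show ?thesis using s y by (simp add: k_def)
  qed
  finally have det: "det g = - (1 / s\<^sup>2)" .
  have "lattice_of g \<inter> norm_ball \<nu> 1 = {0}"
  proof (intro equalityI subsetI)
    fix w assume "w \<in> lattice_of g \<inter> norm_ball \<nu> 1"
    then obtain z where z: "w = g *v z" "\<forall>i. z $ i \<in> \<int>" and w: "\<nu> w < 1"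
      by (auto simp: lattice_of_def norm_ball_def)
    obtain p q where pq: "z $ 1 = real_of_int p" "z $ 2 = real_of_int q" using z(2) by (metis Ints_cases)
    have weq: "w = vector [k * (real_of_int q * x - real_of_int p), k * (real_of_int q * y)]"
      unfolding z(1) g_def matrix_vector_mult_2 pq by (simp add: algebra_simps)
    have \<nu>w: "\<nu> w = k * norm2 \<nu> (real_of_int q * x - real_of_int p) (real_of_int q * y)"
      using N_scale[of k] k by (simp add: weq norm2_def)
    have "(p, q) = (0, 0)"
    proof (rule ccontr)
      assume "(p, q) \<noteq> (0, 0)"
      then have "s * sqrt y \<le> norm2 \<nu> (real_of_int q * x - real_of_int p) (real_of_int q * y)"
        using bad unfolding bad_def by blast
      then have "k * (s * sqrt y) \<le> \<nu> w" unfolding \<nu>w using k by (intro mult_left_mono) auto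
      then show False using k w by simp
    qed
    then show "w \<in> {0}" by (simp add: weq vec_eq_iff forall_2)
  next
    fix w :: "real^2" assume "w \<in> {0}"
    moreover have "\<nu> 0 = 0" using norm by (simp add: is_norm_def)
    moreover have "0 = g *v 0" by simp
    ultimately show "w \<in> lattice_of g \<inter> norm_ball \<nu> 1"
      unfolding lattice_of_def norm_ball_def by (auto intro!: exI[of _ 0])
  qed
  moreover have "invertible g" using det s by (simp add: invertible_det_nz)
  ultimately have "invertible g \<and> lattice_of g \<inter> norm_ball \<nu> 1 = {0}" by simp
  moreover define X where "X = {\<bar>det g\<bar> | g. invertible g \<and> lattice_of g \<inter> norm_ball \<nu> 1 = {0}}"
  ultimately have "\<bar>det g\<bar> \<in> X" unfolding X_def mem_Collect_eq by (intro exI[of _ g] conjI[OF refl])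
  moreover have "bdd_below X"
  proof (rule bdd_belowI[of _ 0])
    fix x assume "x \<in> X"
    then obtain g' :: "real^2^2" where "x = \<bar>det g'\<bar>" unfolding X_def mem_Collect_eq by (elim exE conjE)
    then show "0 \<le> x" by simp
  qed
  ultimately have "crit_covolume \<nu> \<le> \<bar>det g\<bar>"
    unfolding crit_covolume_def X_def[symmetric] by (rule cInf_lower)
  then have "crit_covolume \<nu> \<le> (1 / s)\<^sup>2" using det by (simp add: power_divide)
  then have "sqrt (crit_covolume \<nu>) \<le> 1 / s" using s by (intro real_le_lsqrt) auto
  then show ?thesis using s \<Delta> by (simp add: field_simps)
qed

text \<open>The arguments of \<open>norm2\<close> are the coordinates of the lattice vector after
  applying the inverse of \<open>diag2 (c * psi1 t) t\<close>.\<close>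

lemma Dhat_I:
  assumes c: "0 < c" "c < 1"
    and ev: "\<forall>\<^sub>F t in at_top. \<exists>p q :: int. (p, q) \<noteq> (0, 0) \<and>
      norm2 \<nu> ((real_of_int q * \<alpha> - real_of_int p) * t / c) (real_of_int q / t) < 1 / sqrt (crit_covolume \<nu>)"
  shows "\<alpha> \<in> Dhat \<nu>"
proof -
  have "\<forall>\<^sub>F t in at_top. Lambda \<alpha> \<inter>
      (\<lambda>x. diag2 (c * psi1 t) t *v x) ` norm_ball \<nu> (1 / sqrt (crit_covolume \<nu>)) \<noteq> {0}"
    using ev eventually_gt_at_top[of 0]
  proof eventually_elim
    case (elim t)
    then obtain p q :: int where pq: "(p, q) \<noteq> (0, 0)"
      and lt: "norm2 \<nu> ((real_of_int q * \<alpha> - real_of_int p) * t / c) (real_of_int q / t) < 1 / sqrt (crit_covolume \<nu>)"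
      by blast
    define u :: "real^2" where "u = vector [(real_of_int q * \<alpha> - real_of_int p) * t / c, real_of_int q / t]"
    define w :: "real^2" where "w = vector [\<alpha> * real_of_int q - real_of_int p, real_of_int q]"
    have "diag2 (c * psi1 t) t *v u = w"
      unfolding diag2_def matrix_vector_mult_2 u_def w_def psi1_def using elim(2) c by (simp add: mult.commute)
    moreover have "u \<in> norm_ball \<nu> (1 / sqrt (crit_covolume \<nu>))" using lt by (simp add: norm_ball_def u_def norm2_def)
    ultimately have "w \<in> (\<lambda>x. diag2 (c * psi1 t) t *v x) ` norm_ball \<nu> (1 / sqrt (crit_covolume \<nu>))"
      by (metis image_eqI)
    moreover have "w \<in> Lambda \<alpha>" unfolding Lambda_def w_def by blast
    moreover have "w \<noteq> 0" using pq by (auto simp: w_def vec_eq_iff forall_2)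
    ultimately show ?case by blast
  qed
  then show ?thesis using c unfolding Dhat_def Dset_def by auto
qed

theorem theorem1p3:
  fixes \<nu> :: "real^2 \<Rightarrow> real"
  assumes "is_norm \<nu>"
  shows "absolute_winning (Dhat \<nu>)"
proof -
  obtain K where "plane_norm (norm2 \<nu>) K" using is_norm_plane_norm[OF assms] by blast
  then interpret plane_norm "norm2 \<nu>" K .
  show ?thesis
  proof (cases "0 < crit_covolume \<nu>")
    case True
    define r where "r = 1 / sqrt (crit_covolume \<nu>)"
    then have r: "0 < r" "r = 1 / sqrt (crit_covolume \<nu>)" using True by auto
    show ?thesis
    proof (rule alice_wins[OF r(1)])
      show "\<forall>x y s. 0 < y \<longrightarrow> bad s x y \<longrightarrow> s \<le> r"
        unfolding r(2) using bad_le_critical[OF assms plane_norm_axioms] True by simp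
      show "\<rat> \<subseteq> Dhat \<nu>"
      proof
        fix \<alpha> :: real assume "\<alpha> \<in> \<rat>"
        then obtain p q :: int where pq: "0 < q" "\<alpha> = real_of_int p / real_of_int q" by (rule Rats_cases')
        \<comment> \<open>At a rational \<open>\<alpha>\<close> the vector with coordinates 0 and
          \<open>q\<close> lies in \<open>Lambda \<alpha>\<close>; its rescaled norm
          \<open>A / t\<close> tends to 0, so any \<open>c\<close> would do.\<close>
        define A where "A = norm2 \<nu> 0 (real_of_int q)"
        show "\<alpha> \<in> Dhat \<nu>"
        proof (rule Dhat_I[of "1 / 2"])
          show "\<forall>\<^sub>F t in at_top. \<exists>p q :: int. (p, q) \<noteq> (0, 0) \<and>
            norm2 \<nu> ((real_of_int q * \<alpha> - real_of_int p) * t / (1 / 2)) (real_of_int q / t) < 1 / sqrt (crit_covolume \<nu>)"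
            using eventually_gt_at_top[of "A / r"] eventually_gt_at_top[of 0]
          proof eventually_elim
            case (elim t)
            have "norm2 \<nu> 0 (real_of_int q / t) = A / t"
              using N_scale[of "1 / t" 0 "real_of_int q"] elim(2) by (simp add: A_def)
            also have "\<dots> < r" using elim r(1) by (simp add: field_simps)
            finally show ?case using pq unfolding r(2) by (intro exI[of _ p] exI[of _ q]) simp
          qed
        qed simp_all
      qed
      fix \<alpha> \<epsilon> y0 assume \<epsilon>: "0 < \<epsilon>" "\<epsilon> \<le> r / 2" and y0: "0 < y0"
        and nbad: "\<And>y. 0 < y \<Longrightarrow> y \<le> y0 \<Longrightarrow> \<not> bad (r - \<epsilon>) \<alpha> y"
      \<comment> \<open>The relative gap becomes the factor \<open>c = d\<^sup>2\<close>. At height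
        \<open>y = (d / t)\<^sup>2\<close> the rescaling by \<open>t / d\<^sup>2\<close> turns the
        bound \<open>(r - \<epsilon>) * sqrt y\<close> into exactly \<open>r\<close>.\<close>
      define d where "d = (r - \<epsilon>) / r"
      have d: "0 < d" "d < 1" "d * r = r - \<epsilon>" using \<epsilon> r(1) by (auto simp: d_def field_simps)
      have d2: "0 < d\<^sup>2" "d\<^sup>2 < 1" using d by (auto simp: power_less_one_iff)
      show "\<alpha> \<in> Dhat \<nu>"
      proof (rule Dhat_I[OF d2])
        show "\<forall>\<^sub>F t in at_top. \<exists>p q :: int. (p, q) \<noteq> (0, 0) \<and>
          norm2 \<nu> ((real_of_int q * \<alpha> - real_of_int p) * t / d\<^sup>2) (real_of_int q / t) < 1 / sqrt (crit_covolume \<nu>)"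
          using eventually_gt_at_top[of "d / sqrt y0"] eventually_gt_at_top[of 0]
        proof eventually_elim
          case (elim t)
          define y where "y = (d / t)\<^sup>2"
          have sq: "sqrt y = d / t" using d elim by (simp add: y_def)
          have "d / t < sqrt y0" using elim y0 by (simp add: field_simps)
          then have "y \<le> y0" using sq by (metis less_imp_le real_sqrt_le_iff)
          moreover have "0 < y" using d elim by (simp add: y_def)
          ultimately have "\<not> bad (r - \<epsilon>) \<alpha> y" by (intro nbad)
          then obtain p q :: int where pq: "(p, q) \<noteq> (0, 0)"
            and lt: "norm2 \<nu> (real_of_int q * \<alpha> - real_of_int p) (real_of_int q * y) < (r - \<epsilon>) * sqrt y"
            unfolding bad_def not_le[symmetric] by blast
          have "norm2 \<nu> ((real_of_int q * \<alpha> - real_of_int p) * t / d\<^sup>2) (real_of_int q / t)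
            = t / d\<^sup>2 * norm2 \<nu> (real_of_int q * \<alpha> - real_of_int p) (real_of_int q * y)"
          proof -
            have eq1: "real_of_int q / t = t / d\<^sup>2 * (real_of_int q * y)"
              using d elim by (simp add: y_def field_simps power2_eq_square)
            have eq2: "(real_of_int q * \<alpha> - real_of_int p) * t / d\<^sup>2 = t / d\<^sup>2 * (real_of_int q * \<alpha> - real_of_int p)"
              by simp
            have "\<bar>t / d\<^sup>2\<bar> = t / d\<^sup>2" using elim by simp
            then show ?thesis by (simp only: eq1 eq2 N_scale)
          qed
          also have "\<dots> < t / d\<^sup>2 * ((r - \<epsilon>) * sqrt y)"
            using lt elim d by (intro mult_strict_left_mono) auto
          also have "\<dots> = r" unfolding sq d(3)[symmetric] using d(1,2) elim by (simp add: power2_eq_square)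
          finally show ?case using pq unfolding r(2) by blast
        qed
      qed
    qed
  next
    case False \<comment> \<open>impossible, but then the ball in the definition of \<open>Dset\<close> has radius at most 0 and is empty\<close>
    then have "1 / sqrt (crit_covolume \<nu>) \<le> 0" by simp
    moreover have "0 \<le> \<nu> x" for x using assms by (simp add: is_norm_def)
    ultimately have empty: "norm_ball \<nu> (1 / sqrt (crit_covolume \<nu>)) = {}"
      unfolding norm_ball_def by (smt (verit) empty_Collect_eq)
    have "Dhat \<nu> = UNIV"
      unfolding Dhat_def Dset_def empty by (auto intro!: bexI[of _ "1 / 2"])
    show ?thesis
      unfolding absolute_winning_def
    proof (intro allI impI, elim conjE)
      fix \<beta> :: real assume \<beta>: "0 < \<beta>" "\<beta> < 1 / 3"
      have "alice_strategy \<beta> (\<lambda>h. (0, \<beta> * snd (last h)))" using \<beta> by (simp add: alice_strategy_def)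
      moreover have "(\<Inter>n. ivl (B n)) \<noteq> {}" if bob: "bob_play \<beta> \<sigma> B" for \<sigma> B
      proof -
        obtain x where "x \<in> (\<Inter>n. ivl (B n))"
          by (rule nested_play_common_point[OF \<beta> bob_play_nested[OF bob]])
        then show ?thesis by blast
      qed
      ultimately show "\<exists>\<sigma>. alice_strategy \<beta> \<sigma> \<and> (\<forall>B. bob_play \<beta> \<sigma> B \<longrightarrow> (\<Inter>n. ivl (B n)) \<inter> Dhat \<nu> \<noteq> {})"
        using \<open>Dhat \<nu> = UNIV\<close> by auto
    qed
  qed
qed

end
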